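(* There is an absolute constant $C>0$ such that the following holds for the single-resource, single-type online allocation problem described in the context. Let $\alpha\in(0,\frac18)$ be a constant such that $3\alpha+\frac{C\rho_{\max}}{\sigma_{\min}^3\sqrt{T}}<\frac12$. Then any online algorithm which achieves $\textsc{Envy}\le L_T$ with probability at least $1-\alpha$, where $L_T=o(1)$, must also incur, with probability at least $\frac1{12}-o(1)$, $$\Delta_{efficiency}\;\ge\;\tilde C\,\min\{\sqrt{T},\,1/L_T\}-o(1),$$ where $$\tilde C=\left(\beta_{avg}-o(1)\right)^2\,\frac{\Phi^{-1}\!\left(1-3\alpha-\frac{C\rho_{\max}}{\sigma_{\min}^3\sqrt{T}}\right)^2\sigma_{\min}^2}{24\sqrt{2\rho_{\max}^2\log(T/\alpha)}\;\mu_{\max}} .$$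
   Context: Single-resource, single-type online allocation problem: a budget $B>0$ of one divisible resource is to be divided among individuals arriving over rounds $t=1,\dots,T$. In round $t$ a random number $N_t$ of individuals arrives, where $N_1,\dots,N_T$ are independent with known distributions, $N_t\ge 1$ almost surely, $\mathrm{Var}[N_t]=\sigma_t^2>0$, and $|N_t-\mathbb{E}[N_t]|\le\rho_t<\infty$ almost surely. Put $\sigma_{\min}=\min_t\sigma_t$, $\rho_{\max}=\max_t\rho_t$, $\mu_{\max}=\max_t\mathbb{E}[N_t]$, $N=\sum_{t=1}^T N_t$, and $\beta_{avg}=B/\mathbb{E}[N]$. An online algorithm chooses in each round $t$, after observing $N_1,\dots,N_t$ (but not later arrivals), an allocation $X_t^{alg}\ge 0$ given to each of the $N_t$ individuals of that round; decisions are irrevocable and must satisfy $\sum_{t=1}^T N_tX_t^{alg}\le B$. Each individual's utility equals the allocation received, $u(X)=X$. The hindsight envy is $\textsc{Envy}=\max_{t,t'\in[T]}(X_{t'}^{alg}-X_t^{alg})$, and the waste (efficiency loss) is $\Delta_{efficiency}=B-\sum_{t=1}^T N_tX_t^{alg}$. $\Phi$ is the standard normal cumulative distribution function. Asymptotics: $o(1)$ denotes quantities tending to $0$ as $T\to\infty$, for a sequence of problem instances indexed by $T$ in which $\sigma_{\min},\rho_{\max},\mu_{\max},\beta_{avg}$ are regarded as constants. The convention $1/0=+\infty$ is used. *)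

theory Defs
  imports "HOL-Probability.Probability" "HOL-Library.Landau_Symbols"
begin

text \<open>
  An instance is given by the horizon \<open>T\<close>, the budget \<open>B\<close>, the laws \<open>p t\<close> of the numbers of
  arrivals \<open>N\<^sub>t\<close>, and the almost sure bounds \<open>\<rho> t\<close> on their deviations from the mean,
  where \<open>t\<close> ranges over \<open>{1..T}\<close>.
\<close>

definition mean_arr :: "(nat \<Rightarrow> nat pmf) \<Rightarrow> nat \<Rightarrow> real" where
  "mean_arr p t = measure_pmf.expectation (p t) real"

definition var_arr :: "(nat \<Rightarrow> nat pmf) \<Rightarrow> nat \<Rightarrow> real" where
  "var_arr p t = measure_pmf.variance (p t) real"

definition alloc_instance :: "nat \<Rightarrow> real \<Rightarrow> (nat \<Rightarrow> nat pmf) \<Rightarrow> (nat \<Rightarrow> real) \<Rightarrow> bool" where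
  "alloc_instance T B p \<rho> \<longleftrightarrow>
     1 \<le> T \<and> 0 < B \<and>
     (\<forall>t\<in>{1..T}.
        (AE n in measure_pmf (p t). 1 \<le> n) \<and>
        0 < var_arr p t \<and>
        (AE n in measure_pmf (p t). \<bar>real n - mean_arr p t\<bar> \<le> \<rho> t))"

definition sigma_min :: "nat \<Rightarrow> (nat \<Rightarrow> nat pmf) \<Rightarrow> real" where
  "sigma_min T p = Min ((\<lambda>t. sqrt (var_arr p t)) ` {1..T})"

definition rho_max :: "nat \<Rightarrow> (nat \<Rightarrow> real) \<Rightarrow> real" where
  "rho_max T \<rho> = Max (\<rho> ` {1..T})"

definition mu_max :: "nat \<Rightarrow> (nat \<Rightarrow> nat pmf) \<Rightarrow> real" where
  "mu_max T p = Max (mean_arr p ` {1..T})"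

text \<open>The joint law of the independent arrivals; coordinates outside \<open>{1..T}\<close> are set to 0.\<close>

definition arrivals :: "nat \<Rightarrow> (nat \<Rightarrow> nat pmf) \<Rightarrow> (nat \<Rightarrow> nat) pmf" where
  "arrivals T p = Pi_pmf {1..T} 0 p"

definition beta_avg :: "nat \<Rightarrow> real \<Rightarrow> (nat \<Rightarrow> nat pmf) \<Rightarrow> real" where
  "beta_avg T B p = B / measure_pmf.expectation (arrivals T p) (\<lambda>N. \<Sum>t=1..T. real (N t))"

text \<open>
  An online algorithm maps an internal random seed \<open>u\<close>, drawn from \<open>S\<close> independently of the
  arrivals, and the observed history \<open>[N\<^sub>1, \<dots>, N\<^sub>t]\<close> to the allocation of round \<open>t\<close>.
  Deterministic algorithms are those that ignore the seed.
\<close>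

definition alloc :: "(real \<Rightarrow> nat list \<Rightarrow> real) \<Rightarrow> real \<times> (nat \<Rightarrow> nat) \<Rightarrow> nat \<Rightarrow> real" where
  "alloc alg \<omega> t = alg (fst \<omega>) (map (snd \<omega>) [1..<Suc t])"

definition sample_space ::
    "nat \<Rightarrow> (nat \<Rightarrow> nat pmf) \<Rightarrow> real measure \<Rightarrow> (real \<times> (nat \<Rightarrow> nat)) measure" where
  "sample_space T p S = S \<Otimes>\<^sub>M measure_pmf (arrivals T p)"

definition waste ::
    "nat \<Rightarrow> real \<Rightarrow> (real \<Rightarrow> nat list \<Rightarrow> real) \<Rightarrow> real \<times> (nat \<Rightarrow> nat) \<Rightarrow> real" where
  "waste T B alg \<omega> = B - (\<Sum>t=1..T. real (snd \<omega> t) * alloc alg \<omega> t)"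

definition envy :: "nat \<Rightarrow> (real \<Rightarrow> nat list \<Rightarrow> real) \<Rightarrow> real \<times> (nat \<Rightarrow> nat) \<Rightarrow> real" where
  "envy T alg \<omega> = Max ((\<lambda>(t, t'). alloc alg \<omega> t' - alloc alg \<omega> t) ` ({1..T} \<times> {1..T}))"

definition online_algorithm ::
    "nat \<Rightarrow> real \<Rightarrow> (nat \<Rightarrow> nat pmf) \<Rightarrow> real measure \<Rightarrow> (real \<Rightarrow> nat list \<Rightarrow> real) \<Rightarrow> bool" where
  "online_algorithm T B p S alg \<longleftrightarrow>
     prob_space S \<and> sets S = sets borel \<and>
     (\<forall>h. (\<lambda>u. alg u h) \<in> borel_measurable S) \<and>
     (AE \<omega> in sample_space T p S.
        (\<forall>t\<in>{1..T}. 0 \<le> alloc alg \<omega> t) \<and>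
        (\<Sum>t=1..T. real (snd \<omega> t) * alloc alg \<omega> t) \<le> B)"

definition std_normal_cdf :: "real \<Rightarrow> real" where
  "std_normal_cdf = cdf std_normal_distribution"

text \<open>\<open>std_normal_cdf\<close> is injective with range \<open>{0<..<1}\<close>; only values there are meaningful.\<close>

definition std_normal_quantile :: "real \<Rightarrow> real" where
  "std_normal_quantile = inv std_normal_cdf"

text \<open>\<open>min {\<surd>T, 1 / L}\<close> with the convention \<open>1 / 0 = +\<infinity>\<close>, unlike HOL's \<open>1 / 0 = 0\<close>.\<close>

definition min_rate :: "nat \<Rightarrow> real \<Rightarrow> real" where
  "min_rate T L = (if L = 0 then sqrt (real T) else min (sqrt (real T)) (1 / L))"

text \<open>The factor in front of \<open>min_rate\<close>; \<open>b\<close> stands for \<open>\<beta>\<^sub>a\<^sub>v\<^sub>g - o(1)\<close>.\<close>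

definition C_tilde :: "real \<Rightarrow> real \<Rightarrow> real \<Rightarrow> real \<Rightarrow> real \<Rightarrow> real \<Rightarrow> nat \<Rightarrow> real" where
  "C_tilde C \<alpha> \<sigma> \<rho> \<mu> b T =
     b\<^sup>2 * ((std_normal_quantile (1 - 3 * \<alpha> - C * \<rho> / (\<sigma> ^ 3 * sqrt (real T))))\<^sup>2 * \<sigma>\<^sup>2)
       / (24 * sqrt (2 * \<rho>\<^sup>2 * ln (real T / \<alpha>)) * \<mu>)"

end

theory Submission
  imports Defs "HOL-Real_Asymp.Real_Asymp"
begin

text \<open>
  With probability at least \<open>1 - \<alpha>\<close> all allocations lie within \<open>L\<close> of the first one, \<open>x\<close>. Look at
  the last \<open>s\<close> rounds and let \<open>Y\<close> be the number of arrivals in them, which is independent of the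
  history. The consumption there is between \<open>(x - L) Y\<close> and \<open>(x + L) Y\<close>. By the central limit
  theorem \<open>Y\<close> exceeds its mean by \<open>d = z \<sigma> \<surd>s\<close> with probability at least 2/5, so the budget left
  before these rounds must, up to probability \<open>5\<alpha>/2\<close>, be at least \<open>(x - L) (E Y + d)\<close>. Since also
  \<open>Y \<le> E Y\<close> with probability at least 2/5, the waste is at least \<open>(x - L) d - 2 L E Y\<close> with
  probability at least \<open>2/5 - 2\<alpha> > 1/12\<close>. For \<open>s\<close> of order \<open>min T (1/L\<^sup>2)\<close> this is of order
  \<open>min (\<surd>T) (1/L)\<close>, unless \<open>x\<close> is so small that a constant fraction of the budget is wasted.
  Any positive constant in front suffices, since the logarithm makes \<open>C_tilde\<close> tend to 0.
\<close>

subsection \<open>A central limit theorem uniform over bounded independent summands\<close>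

text \<open>The squeeze \<open>1 - a \<le> exp (- a) \<le> 1 / (1 + a) \<le> 1 - a +
  a\<^sup>2\<close>. It serves to trade the second-order Taylor polynomial of a characteristic
  function for a Gaussian factor.\<close>

lemma exp_minus_bound:
  fixes a :: real
  assumes "0 \<le> a"
  shows "\<bar>(1 - a) - exp (- a)\<bar> \<le> a\<^sup>2"
proof -
  have "exp (- a) \<le> 1 / (1 + a)"
    using exp_ge_add_one_self[of a] assms by (simp add: exp_minus field_simps)
  also have "1 \<le> (1 + a) * (1 - a + a\<^sup>2)"
    using assms by (simp add: algebra_simps power2_eq_square)
  hence "1 / (1 + a) \<le> 1 - a + a\<^sup>2"
    using assms by (simp add: field_simps)
  finally show ?thesis using exp_ge_add_one_self[of "- a"] by auto
qed

lemma abs_cube: "\<bar>x :: real\<bar>^3 = \<bar>x\<bar> * x\<^sup>2"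
  by (cases "0 \<le> x") (simp_all add: power2_eq_square power3_eq_cube)

text \<open>Expanding to second order costs a third absolute moment, which \<open>r\<close> times
  the variance dominates; passing from the polynomial to the exponential costs the square of
  \<open>t\<^sup>2 * v / 2\<close>, where the variance \<open>v\<close> is at most
  \<open>r\<^sup>2\<close>. Both errors are kept proportional to the variance so that they can be
  summed over many summands.\<close>

lemma (in prob_space) char_centred_bounded:
  fixes X :: "'a \<Rightarrow> real"
  assumes X [measurable]: "X \<in> borel_measurable M" and bnd: "AE \<omega> in M. \<bar>X \<omega>\<bar> \<le> r"
    and mean: "expectation X = 0"
  shows "cmod (char (distr M borel X) t - of_real (exp (- (t\<^sup>2 * expectation (\<lambda>\<omega>. (X \<omega>)\<^sup>2) / 2))))
    \<le> \<bar>t\<bar>^3 * r / 6 * expectation (\<lambda>\<omega>. (X \<omega>)\<^sup>2) + t^4 * r\<^sup>2 / 4 * expectation (\<lambda>\<omega>. (X \<omega>)\<^sup>2)"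
proof -
  let ?v = "expectation (\<lambda>\<omega>. (X \<omega>)\<^sup>2)"
  have sq: "AE \<omega> in M. (X \<omega>)\<^sup>2 \<le> r\<^sup>2"
    using bnd by eventually_elim (metis abs_ge_zero power2_abs power_mono)
  have int1 [simp]: "integrable M X"
    by (rule integrable_const_bound[of _ r]) (use bnd in auto)
  have int2 [simp]: "integrable M (\<lambda>\<omega>. (X \<omega>)\<^sup>2)"
    by (rule integrable_const_bound[of _ "r\<^sup>2"]) (use sq in auto)
  have v: "0 \<le> ?v" "?v \<le> r\<^sup>2"
    using integral_mono_AE[OF int2 integrable_const sq] by (auto simp: prob_space)
  have "cmod (char (distr M borel X) t - (1 - t\<^sup>2 * ?v / 2))
    \<le> (t\<^sup>2 / 6) * expectation (\<lambda>\<omega>. min (6 * (X \<omega>)\<^sup>2) (\<bar>t\<bar> * \<bar>X \<omega>\<bar>^3))"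
    by (rule char_approx3'[where X = X]) (simp_all add: mean)
  also have "\<dots> \<le> (t\<^sup>2 / 6) * expectation (\<lambda>\<omega>. \<bar>t\<bar> * r * (X \<omega>)\<^sup>2)"
  proof (rule mult_left_mono[OF integral_mono_AE])
    show "integrable M (\<lambda>\<omega>. min (6 * (X \<omega>)\<^sup>2) (\<bar>t\<bar> * \<bar>X \<omega>\<bar>^3))"
      by (rule Bochner_Integration.integrable_bound[OF integrable_mult_right[OF int2, of 6]]) auto
    show "AE \<omega> in M. min (6 * (X \<omega>)\<^sup>2) (\<bar>t\<bar> * \<bar>X \<omega>\<bar>^3) \<le> \<bar>t\<bar> * r * (X \<omega>)\<^sup>2"
      using bnd
    proof eventually_elim
      case (elim \<omega>)
      have "\<bar>t\<bar> * \<bar>X \<omega>\<bar>^3 = \<bar>t\<bar> * (\<bar>X \<omega>\<bar> * (X \<omega>)\<^sup>2)"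
        by (simp only: abs_cube)
      also have "\<dots> \<le> \<bar>t\<bar> * (r * (X \<omega>)\<^sup>2)"
        using elim by (intro mult_left_mono mult_right_mono) auto
      finally show ?case by (simp add: mult.assoc)
    qed
  qed simp_all
  also have "\<dots> = \<bar>t\<bar>^3 * r / 6 * ?v"
    by (simp add: abs_cube)
  finally have 1: "cmod (char (distr M borel X) t - (1 - t\<^sup>2 * ?v / 2)) \<le> \<bar>t\<bar>^3 * r / 6 * ?v" .
  have "cmod (of_real (1 - t\<^sup>2 * ?v / 2) - of_real (exp (- (t\<^sup>2 * ?v / 2)))) \<le> (t\<^sup>2 * ?v / 2)\<^sup>2"
    unfolding of_real_diff[symmetric] norm_of_real using exp_minus_bound v(1) by simp
  also have "\<dots> = t^4 / 4 * (?v * ?v)"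
    by (simp add: power2_eq_square power4_eq_xxxx)
  also have "\<dots> \<le> t^4 / 4 * (r\<^sup>2 * ?v)"
    by (intro mult_left_mono mult_right_mono v) auto
  finally have 2: "cmod (of_real (1 - t\<^sup>2 * ?v / 2) - of_real (exp (- (t\<^sup>2 * ?v / 2)))) \<le> t^4 * r\<^sup>2 / 4 * ?v"
    by simp
  show ?thesis
    using norm_triangle_mono[OF 1 2] by (simp add: add.commute)
qed

text \<open>Two products of factors of modulus at most 1 differ by at most the sum of the factorwise
  differences. Each difference is bounded by a multiple of the variance of a scaled summand, and
  these variances add up to 1, so the number of summands drops out.\<close>

lemma (in prob_space) char_standardised_sum:
  fixes X :: "'i \<Rightarrow> 'a \<Rightarrow> real"
  assumes fin: "finite I" and indep: "indep_vars (\<lambda>_. borel) X I"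
    and bnd: "\<And>i. i \<in> I \<Longrightarrow> AE \<omega> in M. \<bar>X i \<omega>\<bar> \<le> r"
    and mean: "\<And>i. i \<in> I \<Longrightarrow> expectation (X i) = 0"
    and v: "0 < v" "(\<Sum>i\<in>I. expectation (\<lambda>\<omega>. (X i \<omega>)\<^sup>2)) = v\<^sup>2"
  shows "cmod (char (distr M borel (\<lambda>\<omega>. (\<Sum>i\<in>I. X i \<omega>) / v)) t - of_real (exp (- t\<^sup>2 / 2)))
    \<le> \<bar>t\<bar>^3 * (r / v) / 6 + t^4 * (r / v)\<^sup>2 / 4"
proof -
  let ?Z = "\<lambda>i \<omega>. X i \<omega> / v"
  let ?e = "\<lambda>i. expectation (\<lambda>\<omega>. (?Z i \<omega>)\<^sup>2)"
  have rv [measurable]: "X i \<in> borel_measurable M" if "i \<in> I" for i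
    using indep that unfolding indep_vars_def by auto
  have e: "?e i = expectation (\<lambda>\<omega>. (X i \<omega>)\<^sup>2) / v\<^sup>2" for i
    by (simp add: power_divide)
  have sum_e: "(\<Sum>i\<in>I. ?e i) = 1"
    using v unfolding e sum_divide_distrib[symmetric] by simp
  have "char (distr M borel (\<lambda>\<omega>. (\<Sum>i\<in>I. X i \<omega>) / v)) t
      = (\<Prod>i\<in>I. char (distr M borel (?Z i)) t)"
    unfolding sum_divide_distrib
    by (rule char_distr_sum, rule indep_vars_compose2[OF indep]) auto
  moreover have "exp (- t\<^sup>2 / 2) = (\<Prod>i\<in>I. exp (- (t\<^sup>2 * ?e i / 2)))"
    using sum_e
    by (simp add: exp_sum[OF fin, symmetric] sum_negf sum_divide_distrib[symmetric]
        sum_distrib_left[symmetric] del: power_divide)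
  ultimately have "cmod (char (distr M borel (\<lambda>\<omega>. (\<Sum>i\<in>I. X i \<omega>) / v)) t - of_real (exp (- t\<^sup>2 / 2)))
    \<le> (\<Sum>i\<in>I. cmod (char (distr M borel (?Z i)) t - of_real (exp (- (t\<^sup>2 * ?e i / 2)))))"
    unfolding of_real_prod
    by (simp only: of_real_prod, intro norm_prod_diff)
       (auto intro!: real_distribution.cmod_char_le_1 simp: rv simp del: of_real_exp)
  also have "\<dots> \<le> (\<Sum>i\<in>I. \<bar>t\<bar>^3 * (r / v) / 6 * ?e i + t^4 * (r / v)\<^sup>2 / 4 * ?e i)"
  proof (intro sum_mono char_centred_bounded)
    fix i assume i: "i \<in> I"
    show "?Z i \<in> borel_measurable M" using i by measurable
    show "AE \<omega> in M. \<bar>?Z i \<omega>\<bar> \<le> r / v"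
      using bnd[OF i] v by (auto simp: divide_right_mono)
    show "expectation (?Z i) = 0" using mean[OF i] by simp
  qed
  also have "\<dots> = \<bar>t\<bar>^3 * (r / v) / 6 + t^4 * (r / v)\<^sup>2 / 4"
    unfolding sum.distrib sum_distrib_left[symmetric] sum_e by simp
  finally show ?thesis .
qed

text \<open>A law with a density has no atoms, and a distribution function is continuous exactly at
  the points of mass zero.\<close>

lemma isCont_std_normal_cdf: "isCont std_normal_cdf x"
proof -
  interpret real_distribution std_normal_distribution by (rule real_dist_normal_dist)
  have "AE y in lborel. y \<noteq> x"
    by (rule AE_lborel_singleton)
  hence "emeasure std_normal_distribution {x} = 0"
    by (subst emeasure_density) (auto intro!: nn_integral_0_iff_AE[THEN iffD2] simp: indicator_def)
  thus ?thesis
    unfolding std_normal_cdf_def isCont_cdf by (simp add: measure_def)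
qed

text \<open>The density is even, so reflection gives both closed half-lines the same mass; they
  overlap only in 0, which is not an atom.\<close>

lemma std_normal_cdf_0: "std_normal_cdf 0 = 1 / 2"
proof -
  interpret real_distribution std_normal_distribution by (rule real_dist_normal_dist)
  have "emeasure std_normal_distribution {..0} = (\<integral>\<^sup>+x. ennreal (std_normal_density x) * indicator {..0} x \<partial>lborel)"
    by (rule emeasure_density) auto
  also have "\<dots> = (\<integral>\<^sup>+x. ennreal (std_normal_density (- x)) * indicator {..0} (- x) \<partial>lborel)"
    by (subst lborel_distr_uminus[symmetric], subst nn_integral_distr) auto
  also have "\<dots> = (\<integral>\<^sup>+x. ennreal (std_normal_density x) * indicator {0..} x \<partial>lborel)"
    by (intro nn_integral_cong) (auto simp: normal_density_def indicator_def)
  also have "\<dots> = emeasure std_normal_distribution {0..}"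
    by (rule emeasure_density[symmetric]) auto
  finally have eq: "prob {..0} = prob {0..}" by (simp add: measure_def)
  have "prob {0::real} = 0"
    using isCont_std_normal_cdf[of 0] unfolding std_normal_cdf_def isCont_cdf .
  moreover have "prob {0..} = prob {0::real} + prob {0<..}"
    by (subst finite_measure_Union[symmetric]) (auto intro!: arg_cong[where f = prob])
  moreover have "prob {0<..} = 1 - prob {..0::real}"
    by (subst prob_compl[symmetric]) (auto intro!: arg_cong[where f = prob])
  ultimately show ?thesis using eq by (simp add: std_normal_cdf_def cdf_def)
qed

text \<open>Levy continuity: the array enters the bound on the characteristic functions only through
  \<open>r / v n\<close>, which tends to 0.\<close>

lemma weak_conv_standardised_sums:
  fixes X :: "nat \<Rightarrow> 'i \<Rightarrow> 'a \<Rightarrow> real"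
  assumes M: "\<And>n. prob_space (M n)" and fin: "\<And>n. finite (I n)"
    and indep: "\<And>n. prob_space.indep_vars (M n) (\<lambda>_. borel) (X n) (I n)"
    and bnd: "\<And>n i. i \<in> I n \<Longrightarrow> AE \<omega> in M n. \<bar>X n i \<omega>\<bar> \<le> r"
    and mean: "\<And>n i. i \<in> I n \<Longrightarrow> integral\<^sup>L (M n) (X n i) = 0"
    and v: "\<And>n. 0 < v n" "\<And>n. (\<Sum>i\<in>I n. integral\<^sup>L (M n) (\<lambda>\<omega>. (X n i \<omega>)\<^sup>2)) = (v n)\<^sup>2"
    and lim: "filterlim v at_top sequentially"
  shows "weak_conv_m (\<lambda>n. distr (M n) borel (\<lambda>\<omega>. (\<Sum>i\<in>I n. X n i \<omega>) / v n)) std_normal_distribution"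
proof (rule levy_continuity)
  fix n
  interpret prob_space "M n" by (rule M)
  have [measurable]: "X n i \<in> borel_measurable (M n)" if "i \<in> I n" for i
    using indep[of n] that unfolding indep_vars_def by auto
  show "real_distribution (distr (M n) borel (\<lambda>\<omega>. (\<Sum>i\<in>I n. X n i \<omega>) / v n))"
    by (rule real_distribution_distr) measurable
next
  fix t
  have "(\<lambda>n. r / v n) \<longlonglongrightarrow> 0"
    using tendsto_divide_0[OF tendsto_const filterlim_at_top_imp_at_infinity[OF lim]] by simp
  hence "(\<lambda>n. \<bar>t\<bar>^3 * (r / v n) / 6 + t^4 * (r / v n)\<^sup>2 / 4) \<longlonglongrightarrow> \<bar>t\<bar>^3 * 0 / 6 + t^4 * 0\<^sup>2 / 4"
    by (intro tendsto_intros) auto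
  hence lim0: "(\<lambda>n. \<bar>t\<bar>^3 * (r / v n) / 6 + t^4 * (r / v n)\<^sup>2 / 4) \<longlonglongrightarrow> 0" by simp
  have "(\<lambda>n. char (distr (M n) borel (\<lambda>\<omega>. (\<Sum>i\<in>I n. X n i \<omega>) / v n)) t - of_real (exp (- t\<^sup>2 / 2))) \<longlonglongrightarrow> 0"
    by (rule Lim_null_comparison[OF _ lim0], intro always_eventually allI
        prob_space.char_standardised_sum M fin indep bnd mean v)
  thus "(\<lambda>n. char (distr (M n) borel (\<lambda>\<omega>. (\<Sum>i\<in>I n. X n i \<omega>) / v n)) t)
      \<longlonglongrightarrow> char std_normal_distribution t"
    unfolding char_std_normal_distribution by (rule LIM_zero_cancel)
qed (rule real_dist_normal_dist)

text \<open>A qualitative stand-in for a Berry-Esseen bound. The threshold \<open>V\<close> is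
  chosen before the space and the summands, so later it can be fixed before any instance is
  known.\<close>

lemma uniform_central_limit:
  fixes r x \<eta> :: real
  assumes "0 < \<eta>"
  shows "\<exists>V>0. \<forall>(M :: 'a measure) (I :: 'i set) X v.
    prob_space M \<longrightarrow> finite I \<longrightarrow> prob_space.indep_vars M (\<lambda>_. borel) X I \<longrightarrow>
    (\<forall>i\<in>I. (AE \<omega> in M. \<bar>X i \<omega>\<bar> \<le> r) \<and> integral\<^sup>L M (X i) = 0) \<longrightarrow>
    (\<Sum>i\<in>I. integral\<^sup>L M (\<lambda>\<omega>. (X i \<omega>)\<^sup>2)) = v\<^sup>2 \<longrightarrow> V \<le> v \<longrightarrow>
    \<bar>measure M {\<omega> \<in> space M. (\<Sum>i\<in>I. X i \<omega>) \<le> x * v} - std_normal_cdf x\<bar> \<le> \<eta>"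
proof (rule ccontr)
  define Q where "Q n (M :: 'a measure) (I :: 'i set) X v \<longleftrightarrow>
    prob_space M \<and> finite I \<and> prob_space.indep_vars M (\<lambda>_. borel) X I \<and>
    (\<forall>i\<in>I. (AE \<omega> in M. \<bar>X i \<omega>\<bar> \<le> r) \<and> integral\<^sup>L M (X i) = 0) \<and>
    (\<Sum>i\<in>I. integral\<^sup>L M (\<lambda>\<omega>. (X i \<omega>)\<^sup>2)) = v\<^sup>2 \<and> real (Suc n) \<le> v \<and>
    \<not> \<bar>measure M {\<omega> \<in> space M. (\<Sum>i\<in>I. X i \<omega>) \<le> x * v} - std_normal_cdf x\<bar> \<le> \<eta>"
    for n M I X v
  assume "\<not> ?thesis"
  \<comment> \<open>Counterexamples with growing variance form a triangular array violating weak convergence.\<close>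
  hence "\<exists>M I X v. Q n M I X v" for n
    unfolding Q_def by (meson of_nat_0_less_iff zero_less_Suc)
  then obtain M I X v where "\<And>n. Q n (M n) (I n) (X n) (v n)" by metis
  note h = this[unfolded Q_def]
  have v: "real (Suc n) \<le> v n" for n using h by blast
  have v0: "0 < v n" for n using v[of n] by simp
  have "filterlim v at_top sequentially"
    by (rule filterlim_at_top_mono[OF filterlim_compose[OF filterlim_real_sequentially filterlim_Suc]])
       (use v in auto)
  hence "weak_conv_m (\<lambda>n. distr (M n) borel (\<lambda>\<omega>. (\<Sum>i\<in>I n. X n i \<omega>) / v n)) std_normal_distribution"
    using h v0 by (intro weak_conv_standardised_sums[where r = r]) auto
  hence lim: "(\<lambda>n. cdf (distr (M n) borel (\<lambda>\<omega>. (\<Sum>i\<in>I n. X n i \<omega>) / v n)) x) \<longlonglongrightarrow> std_normal_cdf x"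
    using isCont_std_normal_cdf[of x] unfolding weak_conv_m_def weak_conv_def std_normal_cdf_def by blast
  have "cdf (distr (M n) borel (\<lambda>\<omega>. (\<Sum>i\<in>I n. X n i \<omega>) / v n)) x
      = measure (M n) {\<omega> \<in> space (M n). (\<Sum>i\<in>I n. X n i \<omega>) \<le> x * v n}" for n
  proof -
    interpret prob_space "M n" using h by blast
    have [measurable]: "X n i \<in> borel_measurable (M n)" if "i \<in> I n" for i
      using h[of n] that unfolding indep_vars_def by auto
    show ?thesis
      unfolding cdf_def using v0[of n]
      by (subst measure_distr) (auto intro!: arg_cong[where f = prob] simp: field_simps)
  qed
  with lim have "\<forall>\<^sub>F n in sequentially. dist (measure (M n) {\<omega> \<in> space (M n). (\<Sum>i\<in>I n. X n i \<omega>) \<le> x * v n})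
      (std_normal_cdf x) < \<eta>"
    using tendstoD[OF _ assms] by simp
  then obtain n where "dist (measure (M n) {\<omega> \<in> space (M n). (\<Sum>i\<in>I n. X n i \<omega>) \<le> x * v n})
      (std_normal_cdf x) < \<eta>"
    by (auto simp: eventually_sequentially)
  with h[of n] show False by (simp add: dist_real_def)
qed

section \<open>Spread of the number of arrivals in a block of rounds\<close>

lemma integrable_pmf_bounded_deviation:
  fixes q :: "nat pmf"
  assumes "AE n in measure_pmf q. \<bar>real n - a\<bar> \<le> b"
  shows "integrable (measure_pmf q) real"
proof (rule measure_pmf.integrable_const_bound[where B = "\<bar>a\<bar> + b"])
  show "AE n in measure_pmf q. norm (real n) \<le> \<bar>a\<bar> + b"
    using assms by eventually_elim auto
qed simp

text \<open>The uniform limit theorem at the two points 0 and \<open>z\<close>, where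
  \<open>z\<close> is close enough to 0 that both tails keep nearly half of the mass. Only a lower
  bound on the variances and an upper bound on the deviations enter, so \<open>z\<close> and
  \<open>s\<^sub>0\<close> serve all laws with these bounds.\<close>

lemma pmf_sum_spread:
  fixes \<sigma> \<rho> :: real
  assumes "0 < \<sigma>"
  shows "\<exists>z>0. \<exists>s\<^sub>0. \<forall>(I :: nat set) p. finite I \<longrightarrow> s\<^sub>0 \<le> card I \<longrightarrow>
    (\<forall>i\<in>I. \<sigma>\<^sup>2 \<le> var_arr p i \<and> (AE n in measure_pmf (p i). \<bar>real n - mean_arr p i\<bar> \<le> \<rho>)) \<longrightarrow>
    2 / 5 \<le> measure_pmf.prob (Pi_pmf I 0 p) {N. (\<Sum>i\<in>I. real (N i)) \<le> (\<Sum>i\<in>I. mean_arr p i)} \<and>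
    2 / 5 \<le> measure_pmf.prob (Pi_pmf I 0 p)
      {N. (\<Sum>i\<in>I. mean_arr p i) + z * \<sigma> * sqrt (real (card I)) \<le> (\<Sum>i\<in>I. real (N i))}"
proof -
  \<comment> \<open>The bound 2/5 is 1/2 minus twice 1/20: one share pays for moving from 0 to
    \<open>z\<close>, the other for the error in the limit theorem.\<close>
  have "\<forall>\<^sub>F z in at 0. dist (std_normal_cdf z) (1 / 2) < 1 / 20"
    by (rule tendstoD) (use isCont_std_normal_cdf[of 0] in \<open>simp_all add: isCont_def std_normal_cdf_0\<close>)
  then obtain d where d: "d > 0" "\<And>z. z \<noteq> 0 \<Longrightarrow> dist z 0 < d \<Longrightarrow> dist (std_normal_cdf z) (1 / 2) < 1 / 20"
    by (auto simp: eventually_at)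
  define z where "z = d / 2"
  have z: "0 < z" "std_normal_cdf z \<le> 11 / 20"
    using d(2)[of z] d(1) unfolding z_def dist_real_def by linarith+
  \<comment> \<open>Naming the uniform limit theorem allows its threshold to be chosen as a function
    of the point \<open>x\<close>.\<close>
  define near where "near V x \<longleftrightarrow> (\<forall>(M :: (nat \<Rightarrow> nat) measure) (I :: nat set) X v.
    prob_space M \<longrightarrow> finite I \<longrightarrow> prob_space.indep_vars M (\<lambda>_. borel) X I \<longrightarrow>
    (\<forall>i\<in>I. (AE \<omega> in M. \<bar>X i \<omega>\<bar> \<le> \<rho>) \<and> integral\<^sup>L M (X i) = 0) \<longrightarrow>
    (\<Sum>i\<in>I. integral\<^sup>L M (\<lambda>\<omega>. (X i \<omega>)\<^sup>2)) = v\<^sup>2 \<longrightarrow> V \<le> v \<longrightarrow>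
    \<bar>measure M {\<omega> \<in> space M. (\<Sum>i\<in>I. X i \<omega>) \<le> x * v} - std_normal_cdf x\<bar> \<le> 1 / 20)"
    for V x :: real
  have "\<exists>V>0. near V x" for x
    unfolding near_def by (rule uniform_central_limit) simp
  then obtain V where V: "\<And>x. V x > 0" "\<And>x. near (V x) x" by metis
  \<comment> \<open>The standard deviation of the sum is at least
    \<open>\<sigma> * sqrt (card I)\<close>, which passes both thresholds from this cardinality
    on.\<close>
  define s\<^sub>0 where "s\<^sub>0 = nat \<lceil>((max (V 0) (V z)) / \<sigma>)\<^sup>2\<rceil>"
  show ?thesis
  proof (intro exI[of _ z] conjI exI[of _ s\<^sub>0] allI impI; (rule z)?)
    fix I :: "nat set" and p
    assume I: "finite I" "s\<^sub>0 \<le> card I" and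
      p: "\<forall>i\<in>I. \<sigma>\<^sup>2 \<le> var_arr p i \<and> (AE n in measure_pmf (p i). \<bar>real n - mean_arr p i\<bar> \<le> \<rho>)"
    let ?P = "Pi_pmf I 0 p"
    let ?X = "\<lambda>i N. real (N i) - mean_arr p i"
    define v where "v = sqrt (\<Sum>i\<in>I. var_arr p i)"
    have comp: "p i = map_pmf (\<lambda>N. N i) (Pi_pmf I 0 p)" if "i \<in> I" for i
      using Pi_pmf_component[OF I(1), of i 0 p] that by simp
    have integral_comp: "measure_pmf.expectation ?P (\<lambda>N. f (N i)) = measure_pmf.expectation (p i) f"
      if "i \<in> I" for i and f :: "nat \<Rightarrow> real"
      unfolding comp[OF that] by simp
    have bnd: "AE N in measure_pmf ?P. \<bar>?X i N\<bar> \<le> \<rho>" if "i \<in> I" for i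
    proof -
      have "AE n in measure_pmf (p i). \<bar>real n - mean_arr p i\<bar> \<le> \<rho>" using p that by blast
      thus ?thesis unfolding comp[OF that] by (simp add: AE_measure_pmf_iff)
    qed
    have int: "integrable (measure_pmf (p i)) real" if "i \<in> I" for i
      using p that by (intro integrable_pmf_bounded_deviation[where a = "mean_arr p i" and b = \<rho>]) auto
    have mean: "measure_pmf.expectation ?P (?X i) = 0" if "i \<in> I" for i
      using integral_comp[OF that, of "\<lambda>n. real n - mean_arr p i"] int[OF that]
      by (simp add: mean_arr_def)
    have var: "measure_pmf.expectation ?P (\<lambda>N. (?X i N)\<^sup>2) = var_arr p i" if "i \<in> I" for i
      using integral_comp[OF that, of "\<lambda>n. (real n - mean_arr p i)\<^sup>2"]
      by (simp add: var_arr_def mean_arr_def)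
    have indep: "prob_space.indep_vars ?P (\<lambda>_. borel) ?X I"
      by (rule prob_space.indep_vars_compose2[OF measure_pmf.prob_space_axioms, OF indep_vars_Pi_pmf[OF I(1)]]) simp
    have v2: "(\<Sum>i\<in>I. var_arr p i) = v\<^sup>2"
      unfolding v_def by (rule real_sqrt_pow2[symmetric], rule sum_nonneg) (use p in \<open>auto intro: order_trans[OF zero_le_power2]\<close>)
    have "real (card I) * \<sigma>\<^sup>2 \<le> (\<Sum>i\<in>I. var_arr p i)"
      using p sum_mono[of I "\<lambda>_. \<sigma>\<^sup>2" "var_arr p"] by simp
    hence "sqrt (real (card I) * \<sigma>\<^sup>2) \<le> v"
      unfolding v_def by (rule real_sqrt_le_mono)
    hence v: "\<sigma> * sqrt (real (card I)) \<le> v"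
      using assms by (simp add: real_sqrt_mult mult.commute)
    have "(max (V 0) (V z) / \<sigma>)\<^sup>2 \<le> real (card I)"
      using I(2) unfolding s\<^sub>0_def by linarith
    hence "max (V 0) (V z) / \<sigma> \<le> sqrt (real (card I))"
      by (rule real_le_rsqrt)
    hence Vv: "V 0 \<le> v" "V z \<le> v"
      using v assms by (auto simp: field_simps)
    have near': "\<bar>measure_pmf.prob ?P {N. (\<Sum>i\<in>I. ?X i N) \<le> x * v} - std_normal_cdf x\<bar> \<le> 1 / 20"
      if "V x \<le> v" for x
      using V(2)[of x, unfolded near_def, rule_format, OF measure_pmf.prob_space_axioms I(1) indep _ _ that]
        bnd mean var v2 by simp
    show "2 / 5 \<le> measure_pmf.prob ?P {N. (\<Sum>i\<in>I. real (N i)) \<le> (\<Sum>i\<in>I. mean_arr p i)}"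
      using near'[OF Vv(1)]
      unfolding std_normal_cdf_0 sum_subtractf mult_zero_left diff_le_0_iff_le by linarith
    have "2 / 5 \<le> 1 - measure_pmf.prob ?P {N. (\<Sum>i\<in>I. ?X i N) \<le> z * v}"
      using near'[OF Vv(2)] z by linarith
    also have "\<dots> = measure_pmf.prob ?P {N. \<not> (\<Sum>i\<in>I. ?X i N) \<le> z * v}"
      by (subst measure_pmf.prob_compl[symmetric]) (auto intro!: arg_cong[where f = "measure_pmf.prob ?P"])
    also have "\<dots> \<le> measure_pmf.prob ?P {N. (\<Sum>i\<in>I. mean_arr p i) + z * \<sigma> * sqrt (real (card I)) \<le> (\<Sum>i\<in>I. real (N i))}"
    proof (rule measure_pmf.finite_measure_mono, safe)
      fix N assume "\<not> (\<Sum>i\<in>I. ?X i N) \<le> z * v"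
      thus "(\<Sum>i\<in>I. mean_arr p i) + z * \<sigma> * sqrt (real (card I)) \<le> (\<Sum>i\<in>I. real (N i))"
        using mult_left_mono[OF v, of z] z unfolding sum_subtractf mult.assoc by linarith
    qed simp
    finally show "2 / 5 \<le> measure_pmf.prob ?P {N. (\<Sum>i\<in>I. mean_arr p i) + z * \<sigma> * sqrt (real (card I)) \<le> (\<Sum>i\<in>I. real (N i))}" .
  qed
qed

subsection \<open>Independence of disjoint blocks of coordinates\<close>

lemma prob_pair_pmf_Times:
  "measure_pmf.prob (pair_pmf p q) (A \<times> B) = measure_pmf.prob p A * measure_pmf.prob q B"
proof -
  have "emeasure (measure_pmf (pair_pmf p q)) (A \<times> B)
      = (\<integral>\<^sup>+x. indicator (A \<times> B) x \<partial>measure_pmf (pair_pmf p q))"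
    by simp
  also have "\<dots> = (\<integral>\<^sup>+a. \<integral>\<^sup>+b. indicator A a * indicator B b \<partial>measure_pmf q \<partial>measure_pmf p)"
    unfolding nn_integral_pair_pmf' by (simp add: indicator_times)
  also have "\<dots> = emeasure (measure_pmf p) A * emeasure (measure_pmf q) B"
    by (simp add: nn_integral_cmult nn_integral_multc)
  finally show ?thesis by (simp add: measure_def enn2real_mult)
qed

text \<open>The product over \<open>A \<union> B\<close> is the image of a pair of independent
  blocks under merging. Each predicate sees only its own block, so the event pulls back to a
  rectangle.\<close>

lemma prob_Pi_pmf_union:
  assumes "finite A" "finite B" "A \<inter> B = {}"
    and P: "\<And>N N'. (\<And>i. i \<in> A \<Longrightarrow> N i = N' i) \<Longrightarrow> P N = P N'"
    and R: "\<And>N N'. (\<And>i. i \<in> B \<Longrightarrow> N i = N' i) \<Longrightarrow> R N = R N'"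
  shows "measure_pmf.prob (Pi_pmf (A \<union> B) d p) {N. P N \<and> R N} =
    measure_pmf.prob (Pi_pmf A d p) {N. P N} * measure_pmf.prob (Pi_pmf B d p) {N. R N}"
proof -
  have "P (\<lambda>x. if x \<in> A then f x else g x) = P f" "R (\<lambda>x. if x \<in> A then f x else g x) = R g" for f g
    using assms(3) by (auto intro!: P R)
  hence "(\<lambda>(f, g) x. if x \<in> A then f x else g x) -` {N. P N \<and> R N} = {N. P N} \<times> {N. R N}"
    by auto
  thus ?thesis
    unfolding Pi_pmf_union[OF assms(1-3)]
    by (simp add: measure_map_pmf prob_pair_pmf_Times del: vimage_Collect_eq)
qed

text \<open>Fubini over the seed: for each fixed \<open>u\<close> the blocks factorise, and the
  factor of \<open>R\<close> does not depend on \<open>u\<close>. This makes late arrivals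
  independent of whatever a randomised algorithm did earlier.\<close>

lemma prob_pair_Pi_pmf_indep:
  fixes S :: "'a measure" and p :: "'i \<Rightarrow> 'b pmf" and d :: "'b"
  assumes "prob_space S" "finite A" "finite B" "A \<inter> B = {}"
  defines "M \<equiv> S \<Otimes>\<^sub>M measure_pmf (Pi_pmf (A \<union> B) d p)"
  assumes meas: "Measurable.pred M P"
    and P: "\<And>u N N'. (\<And>i. i \<in> A \<Longrightarrow> N i = N' i) \<Longrightarrow> P (u, N) = P (u, N')"
    and R: "\<And>N N'. (\<And>i. i \<in> B \<Longrightarrow> N i = N' i) \<Longrightarrow> R N = R N'"
  shows "measure M {\<omega> \<in> space M. P \<omega> \<and> R (snd \<omega>)} =
    measure M {\<omega> \<in> space M. P \<omega>} * measure_pmf.prob (Pi_pmf B d p) {N. R N}"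
proof -
  let ?D = "Pi_pmf (A \<union> B) d p" and ?r = "measure_pmf.prob (Pi_pmf B d p) {N. R N}"
  interpret S: prob_space S by fact
  interpret D: prob_space "measure_pmf ?D" by (rule measure_pmf.prob_space_axioms)
  interpret pair_prob_space S "measure_pmf ?D" ..
  have [measurable]: "Measurable.pred M P" by (rule meas)
  have [measurable]: "Measurable.pred M (\<lambda>\<omega>. R (snd \<omega>))"
    unfolding M_def by (rule measurable_compose[OF measurable_snd]) simp
  have slice: "emeasure (measure_pmf ?D) {N. P (u, N) \<and> R N} = emeasure (measure_pmf ?D) {N. P (u, N)} * ennreal ?r"
    for u
  proof -
    have 1: "measure_pmf.prob ?D {N. P (u, N) \<and> R N} = measure_pmf.prob (Pi_pmf A d p) {N. P (u, N)} * ?r"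
      by (rule prob_Pi_pmf_union[OF assms(2-4) P R])
    \<comment> \<open>The trivial event on \<open>B\<close> shows that \<open>P\<close> has the same
      probability under the full product as under its \<open>A\<close> block.\<close>
    have "measure_pmf.prob ?D {N. P (u, N) \<and> True} = measure_pmf.prob (Pi_pmf A d p) {N. P (u, N)} *
        measure_pmf.prob (Pi_pmf B d p) {N. True}"
      by (rule prob_Pi_pmf_union[OF assms(2-4) P refl])
    with 1 show ?thesis
      by (simp add: measure_pmf.emeasure_eq_measure ennreal_mult)
  qed
  have set1: "{\<omega> \<in> space M. P \<omega> \<and> R (snd \<omega>)} \<in> sets (S \<Otimes>\<^sub>M measure_pmf ?D)"
    unfolding M_def[symmetric] by measurable
  have set2: "{\<omega> \<in> space M. P \<omega>} \<in> sets (S \<Otimes>\<^sub>M measure_pmf ?D)"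
    unfolding M_def[symmetric] by measurable
  have "emeasure M {\<omega> \<in> space M. P \<omega> \<and> R (snd \<omega>)} =
      (\<integral>\<^sup>+u. emeasure (measure_pmf ?D) {N. P (u, N) \<and> R N} \<partial>S)"
    unfolding M_def measure_pmf.emeasure_pair_measure_alt[OF set1[unfolded M_def]]
    by (intro nn_integral_cong arg_cong2[where f = emeasure]) (auto simp: space_pair_measure)
  also have "\<dots> = (\<integral>\<^sup>+u. emeasure (measure_pmf ?D) (Pair u -` {\<omega> \<in> space M. P \<omega>}) * ennreal ?r \<partial>S)"
    unfolding slice
    by (intro nn_integral_cong arg_cong2[where f = "(*)"] arg_cong2[where f = emeasure] refl)
       (auto simp: space_pair_measure M_def)
  also have "\<dots> = emeasure M {\<omega> \<in> space M. P \<omega>} * ennreal ?r"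
    unfolding M_def measure_pmf.emeasure_pair_measure_alt[OF set2[unfolded M_def]]
    by (rule nn_integral_multc) (rule measure_pmf.measurable_emeasure_Pair[OF set2[unfolded M_def]])
  finally show ?thesis
    by (simp add: measure_def enn2real_mult)
qed

subsection \<open>Asymptotics of the rate\<close>

text \<open>The quantile is defined by \<open>inv\<close>, so membership in the range has to come
  first: the intermediate value theorem supplies it between points \<open>y\<close> and
  \<open>x\<close> whose values enclose \<open>[1 / 2, a]\<close>. Monotonicity then traps the
  quantile between the same two points.\<close>

lemma std_normal_quantile_bounded:
  assumes "a < 1"
  shows "\<exists>K. \<forall>q. 1 / 2 \<le> q \<longrightarrow> q \<le> a \<longrightarrow> \<bar>std_normal_quantile q\<bar> \<le> K"
proof -
  interpret real_distribution std_normal_distribution by (rule real_dist_normal_dist)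
  have mono: "std_normal_cdf x \<le> std_normal_cdf y" if "x \<le> y" for x y
    unfolding std_normal_cdf_def by (rule cdf_nondecreasing[OF that])
  have "\<forall>\<^sub>F x in at_top. a < std_normal_cdf x"
    using cdf_lim_at_top_prob assms unfolding std_normal_cdf_def by (rule order_tendstoD)
  then obtain x where x: "a < std_normal_cdf x" by (auto simp: eventually_at_top_linorder)
  have "\<forall>\<^sub>F y in at_bot. std_normal_cdf y < 1 / 2"
    using cdf_lim_at_bot unfolding std_normal_cdf_def by (rule order_tendstoD) simp
  then obtain y where y: "std_normal_cdf y < 1 / 2" by (auto simp: eventually_at_bot_linorder)
  show ?thesis
  proof (intro exI[of _ "max \<bar>x\<bar> \<bar>y\<bar>"] allI impI)
    fix q :: real assume q: "1 / 2 \<le> q" "q \<le> a"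
    have "y \<le> x" using mono[of x y] x y q by linarith
    hence "\<exists>w. y \<le> w \<and> w \<le> x \<and> std_normal_cdf w = q"
      using x y q by (intro IVT) (auto intro: isCont_std_normal_cdf)
    hence "q \<in> range std_normal_cdf" by blast
    hence "std_normal_cdf (std_normal_quantile q) = q"
      unfolding std_normal_quantile_def by (rule f_inv_into_f)
    with x y q mono[of x "std_normal_quantile q"] mono[of "std_normal_quantile q" y]
    show "\<bar>std_normal_quantile q\<bar> \<le> max \<bar>x\<bar> \<bar>y\<bar>" by linarith
  qed
qed

text \<open>Under the smallness condition the argument of the quantile lies between 1/2 and
  \<open>1 - 3 * \<alpha>\<close>, so the numerator stays bounded, while the denominator grows like
  the square root of \<open>ln T\<close>.\<close>

lemma C_tilde_vanishes:
  assumes "0 < \<alpha>" "0 < \<sigma>" "0 < \<rho>" "0 < \<mu>" "0 < c" "0 \<le> C"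
  shows "\<forall>\<^sub>F T in sequentially. 3 * \<alpha> + C * \<rho> / (\<sigma> ^ 3 * sqrt (real T)) < 1 / 2 \<longrightarrow>
    C_tilde C \<alpha> \<sigma> \<rho> \<mu> b T \<le> c"
proof -
  obtain K where K: "\<And>q. 1 / 2 \<le> q \<Longrightarrow> q \<le> 1 - 3 * \<alpha> \<Longrightarrow> \<bar>std_normal_quantile q\<bar> \<le> K"
    using std_normal_quantile_bounded[of "1 - 3 * \<alpha>"] assms by auto
  define d where "d T = 24 * sqrt (2 * \<rho>\<^sup>2 * ln (real T / \<alpha>)) * \<mu>" for T
  have "filterlim d at_top sequentially"
    unfolding d_def using assms by real_asymp
  \<comment> \<open>The 1 in the maximum keeps the denominator positive for the final
    division.\<close>
  hence "\<forall>\<^sub>F T in sequentially. max 1 (b\<^sup>2 * (K\<^sup>2 * \<sigma>\<^sup>2) / c) \<le> d T"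
    unfolding filterlim_at_top by blast
  thus ?thesis
  proof eventually_elim
    case (elim T)
    show ?case
    proof
      assume h: "3 * \<alpha> + C * \<rho> / (\<sigma> ^ 3 * sqrt (real T)) < 1 / 2"
      define q where "q = 1 - 3 * \<alpha> - C * \<rho> / (\<sigma> ^ 3 * sqrt (real T))"
      have "0 \<le> C * \<rho> / (\<sigma> ^ 3 * sqrt (real T))" using assms by simp
      hence "\<bar>std_normal_quantile q\<bar> \<le> K"
        using h by (intro K) (auto simp: q_def)
      hence "(std_normal_quantile q)\<^sup>2 \<le> K\<^sup>2"
        by (metis abs_ge_zero power2_abs power_mono)
      hence "b\<^sup>2 * ((std_normal_quantile q)\<^sup>2 * \<sigma>\<^sup>2) \<le> b\<^sup>2 * (K\<^sup>2 * \<sigma>\<^sup>2)"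
        by (intro mult_left_mono mult_right_mono) auto
      also have "\<dots> \<le> c * d T"
        using elim assms(5) by (simp add: field_simps)
      finally show "C_tilde C \<alpha> \<sigma> \<rho> \<mu> b T \<le> c"
        using elim unfolding C_tilde_def q_def[symmetric] d_def[symmetric]
        by (simp add: field_simps)
    qed
  qed
qed

section \<open>The rate and a matching number of final rounds\<close>

lemma min_rate_nonneg: "0 \<le> L \<Longrightarrow> 0 \<le> min_rate T L"
  by (simp add: min_rate_def)

lemma min_rate_le_sqrt: "min_rate T L \<le> sqrt (real T)"
  by (simp add: min_rate_def)

text \<open>Take \<open>s\<close> as the smaller of \<open>T - 1\<close> and the integer part of
  \<open>(\<delta> / L T)\<^sup>2\<close>, or \<open>T - 1\<close> if \<open>L T = 0\<close>. Then
  \<open>s\<close> is large enough for the normal approximation, the envy term stays below the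
  fluctuation of order \<open>sqrt s\<close>, and that fluctuation has the order of the rate.
  Strictness of \<open>s < T\<close> leaves round 1 in the history.\<close>

lemma final_rounds:
  fixes L :: "nat \<Rightarrow> real" and \<delta> :: real
  assumes L: "L \<in> o(\<lambda>_. 1)" and \<delta>: "0 < \<delta>"
  shows "\<forall>\<^sub>F T in sequentially. 0 \<le> L T \<longrightarrow> (\<exists>s. s\<^sub>0 \<le> s \<and> s < T \<and>
    L T * sqrt (real s) \<le> \<delta> \<and> min (1 / 2) (\<delta> / 2) * min_rate T (L T) \<le> sqrt (real s))"
proof -
  have L0: "L \<longlonglongrightarrow> 0"
    using L by (auto dest: smalloD_tendsto)
  \<comment> \<open>\<open>L T < e\<close> means that \<open>\<delta> / L T\<close> exceeds
    \<open>sqrt (Suc s\<^sub>0)\<close>, so its squared integer part is at least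
    \<open>Suc s\<^sub>0\<close>.\<close>
  define e where "e = \<delta> / sqrt (real (Suc s\<^sub>0))"
  have "e > 0" using \<delta> by (simp add: e_def)
  hence "\<forall>\<^sub>F T in sequentially. L T < e"
    using L0 by (rule order_tendstoD(2)[rotated])
  moreover have "\<forall>\<^sub>F T in sequentially. s\<^sub>0 + 2 \<le> T"
    by (rule eventually_ge_at_top)
  ultimately show ?thesis
  proof eventually_elim
    case (elim T)
    show ?case
    proof
      assume L: "0 \<le> L T"
      \<comment> \<open>Since \<open>T \<ge> 2\<close>, giving up one round keeps at least a quarter
        of the horizon.\<close>
      have T: "sqrt (real T) / 2 \<le> sqrt (real (T - 1))"
        using elim(2) by (intro real_le_rsqrt) (simp add: power_divide of_nat_diff)
      show "\<exists>s. s\<^sub>0 \<le> s \<and> s < T \<and>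
        L T * sqrt (real s) \<le> \<delta> \<and> min (1 / 2) (\<delta> / 2) * min_rate T (L T) \<le> sqrt (real s)"
      proof (cases "L T = 0")
        case True
        have "min (1 / 2) (\<delta> / 2) * min_rate T (L T) \<le> 1 / 2 * sqrt (real T)"
          using \<delta> by (intro mult_mono min_rate_le_sqrt min_rate_nonneg L) auto
        with T elim(2) True \<delta> show ?thesis by (intro exI[of _ "T - 1"]) auto
      next
        case False
        define y where "y = \<delta> / L T"
        define k where "k = nat \<lfloor>y\<^sup>2\<rfloor>"
        have Lpos: "0 < L T" using L False by simp
        have y: "0 < y" "sqrt (real (Suc s\<^sub>0)) \<le> y"
          using elim(1) Lpos \<delta> by (auto simp: y_def e_def field_simps)
        have "real (Suc s\<^sub>0) \<le> y\<^sup>2"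
          using y(2) by (rule sqrt_le_D)
        hence k: "Suc s\<^sub>0 \<le> k"
          unfolding k_def by (simp add: le_nat_floor)
        have k_le: "real k \<le> y\<^sup>2"
          unfolding k_def by simp
        \<comment> \<open>Rounding down loses at most a factor 4, because \<open>k \<ge> 1\<close>
          gives \<open>k + 1 \<le> 4 * k\<close>.\<close>
        have "y\<^sup>2 < real k + 1" unfolding k_def by linarith
        hence k_ge: "(y / 2)\<^sup>2 \<le> real k"
          using k by (simp add: power_divide)
        define s where "s = min (T - 1) k"
        have "sqrt (real s) \<le> y"
          using k_le y(1) by (intro real_le_lsqrt) (auto simp: s_def)
        hence 1: "L T * sqrt (real s) \<le> \<delta>"
          using Lpos by (simp add: y_def field_simps)
        have min_rate: "min_rate T (L T) = min (sqrt (real T)) (1 / L T)"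
          using False by (simp add: min_rate_def)
        have c: "0 \<le> min (1 / 2) (\<delta> / 2)" using \<delta> by simp
        have "min (1 / 2) (\<delta> / 2) * min_rate T (L T) \<le> 1 / 2 * sqrt (real T)"
          using \<delta> by (intro mult_mono min_rate_le_sqrt min_rate_nonneg L) auto
        moreover have "min (1 / 2) (\<delta> / 2) * min_rate T (L T) \<le> \<delta> / 2 * (1 / L T)"
          using \<delta> L by (intro mult_mono) (auto simp: min_rate)
        moreover have "\<delta> / 2 * (1 / L T) \<le> sqrt (real k)"
          using real_le_rsqrt[OF k_ge] by (simp add: y_def)
        ultimately have "min (1 / 2) (\<delta> / 2) * min_rate T (L T) \<le> sqrt (real s)"
          using T by (auto simp: s_def min_def)
        with 1 k elim(2) show ?thesis
          by (intro exI[of _ s]) (auto simp: s_def)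
      qed
    qed
  qed
qed

subsection \<open>Waste in the final rounds\<close>

lemma envy_nonneg:
  assumes "1 \<le> T"
  shows "0 \<le> envy T alg \<omega>"
proof -
  have "alloc alg \<omega> 1 - alloc alg \<omega> 1 \<le> envy T alg \<omega>"
    unfolding envy_def using assms by (intro Max_ge) (auto intro!: image_eqI[of _ _ "(1, 1)"])
  thus ?thesis by simp
qed

lemma alloc_diff_le_envy:
  assumes "t \<in> {1..T}" "t' \<in> {1..T}"
  shows "alloc alg \<omega> t' - alloc alg \<omega> t \<le> envy T alg \<omega>"
  unfolding envy_def using assms by (intro Max_ge) (auto intro!: image_eqI[of _ _ "(t, t')"])

text \<open>This is where being online enters: the history list stops at round
  \<open>t\<close>.\<close>

lemma alloc_cong:
  assumes "\<And>i. i \<in> {1..t} \<Longrightarrow> N i = N' i"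
  shows "alloc alg (u, N) t = alloc alg (u, N') t"
  unfolding alloc_def using assms by (auto intro!: arg_cong[where f = "alg u"] map_cong)

text \<open>There are only countably many histories, so measurability in the seed for each fixed
  history is enough.\<close>

lemma measurable_alloc:
  assumes "online_algorithm T B p S alg"
  shows "(\<lambda>\<omega>. alloc alg \<omega> t) \<in> borel_measurable (sample_space T p S)"
  unfolding alloc_def
proof (rule measurable_compose_countable)
  fix h :: "nat list"
  have "(\<lambda>u. alg u h) \<in> borel_measurable S"
    using assms by (simp add: online_algorithm_def)
  thus "(\<lambda>\<omega>. alg (fst \<omega>) h) \<in> borel_measurable (sample_space T p S)"
    unfolding sample_space_def by measurable
next
  show "(\<lambda>\<omega>. map (snd \<omega>) [1..<Suc t]) \<in> sample_space T p S \<rightarrow>\<^sub>M count_space UNIV"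
    unfolding sample_space_def by (rule measurable_compose[OF measurable_snd]) simp
qed

lemma measurable_snd_sample_space:
  "(\<lambda>\<omega>. f (snd \<omega>)) \<in> sample_space T p S \<rightarrow>\<^sub>M count_space UNIV"
  unfolding sample_space_def by (rule measurable_compose[OF measurable_snd]) simp

lemma AE_sample_space_arrivals:
  assumes "prob_space S" "\<And>t. t \<in> {1..T} \<Longrightarrow> AE n in measure_pmf (p t). Q t n"
  shows "AE \<omega> in sample_space T p S. \<forall>t\<in>{1..T}. Q t (snd \<omega> t)"
proof -
  interpret S: prob_space S by fact
  interpret pair_prob_space S "measure_pmf (arrivals T p)" ..
  have "AE N in measure_pmf (arrivals T p). \<forall>t\<in>{1..T}. Q t (N t)"
    using assms(2) by (auto simp: AE_measure_pmf_iff arrivals_def set_Pi_pmf PiE_dflt_def)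
  moreover have "Measurable.pred (sample_space T p S) (\<lambda>\<omega>. \<forall>t\<in>{1..T}. Q t (snd \<omega> t))"
    by (rule measurable_snd_sample_space[of "\<lambda>N. \<forall>t\<in>{1..T}. Q t (N t)"])
  ultimately show ?thesis
    unfolding sample_space_def by (intro AE_pair_measure) (auto simp: pred_def)
qed

text \<open>Late consumption is at least \<open>x * y\<close>, which is more than what is left. In
  the application \<open>x\<close> is the first allocation minus the envy bound.\<close>

lemma final_rounds_overspend:
  fixes N X :: "nat \<Rightarrow> real"
  assumes m: "m \<le> T"
    and N: "\<And>t. t \<in> {1..T} \<Longrightarrow> 0 \<le> N t"
    and X: "\<And>t. t \<in> {m<..T} \<Longrightarrow> x \<le> X t" "0 < x"
    and less: "B - (\<Sum>t=1..m. N t * X t) < x * y" and y: "y \<le> (\<Sum>t\<in>{m<..T}. N t)"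
  shows "B < (\<Sum>t=1..T. N t * X t)"
proof -
  have split: "{1..T} = {1..m} \<union> {m<..T}" using m by auto
  have "x * y \<le> (\<Sum>t\<in>{m<..T}. N t * x)"
    using mult_left_mono[OF y, of x] X(2) by (simp add: sum_distrib_left mult.commute)
  also have "\<dots> \<le> (\<Sum>t\<in>{m<..T}. N t * X t)"
    using X(1) N by (intro sum_mono mult_left_mono) auto
  finally show ?thesis
    using less unfolding split by (subst sum.union_disjoint) auto
qed

text \<open>Subtracting the late consumption, at most \<open>(x + L) * y\<close>, from the reserve
  leaves \<open>(x - L) * d - 2 * L * y\<close>. If instead \<open>x - L < \<kappa>\<close>, every
  allocation is at most \<open>\<kappa> + 2 * L\<close>, and the whole horizon consumes at most that
  times \<open>K * T\<close>.\<close>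

lemma final_rounds_underspend:
  fixes N X :: "nat \<Rightarrow> real"
  assumes m: "m \<le> T"
    and N: "\<And>t. t \<in> {1..T} \<Longrightarrow> 0 \<le> N t" "\<And>t. t \<in> {1..T} \<Longrightarrow> N t \<le> K"
    and X: "\<And>t. t \<in> {1..T} \<Longrightarrow> X t \<le> x + L" "0 \<le> x" "0 \<le> L" "0 \<le> \<kappa>"
    and d: "0 \<le> d" and y: "(\<Sum>t\<in>{m<..T}. N t) \<le> y"
    and reserve: "\<kappa> \<le> x - L \<Longrightarrow> (x - L) * (y + d) \<le> B - (\<Sum>t=1..m. N t * X t)"
  shows "min (\<kappa> * d - 2 * L * y) (B - (\<kappa> + 2 * L) * (K * real T)) \<le> B - (\<Sum>t=1..T. N t * X t)"
proof (cases "\<kappa> \<le> x - L")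
  case True
  have split: "{1..T} = {1..m} \<union> {m<..T}" using m by auto
  have "(\<Sum>t\<in>{m<..T}. N t * X t) \<le> (\<Sum>t\<in>{m<..T}. N t * (x + L))"
    using X(1) N by (intro sum_mono mult_left_mono) auto
  also have "\<dots> \<le> y * (x + L)"
    using y X by (simp add: sum_distrib_right[symmetric] mult_right_mono)
  finally have "(x - L) * (y + d) - y * (x + L) \<le> B - (\<Sum>t=1..T. N t * X t)"
    using reserve[OF True] unfolding split by (subst sum.union_disjoint) auto
  moreover have "(x - L) * (y + d) - y * (x + L) = (x - L) * d - 2 * L * y"
    by (simp add: algebra_simps)
  moreover have "\<kappa> * d \<le> (x - L) * d"
    using True d by (rule mult_right_mono)
  ultimately show ?thesis by linarith
next
  case False
  have "(\<Sum>t=1..T. N t * X t) \<le> (\<Sum>t=1..T. N t * (\<kappa> + 2 * L))"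
    using X(1) N False by (intro sum_mono mult_left_mono order_trans[OF X(1)]) auto
  also have "\<dots> \<le> (\<Sum>t=1..T. K * (\<kappa> + 2 * L))"
    using N X by (intro sum_mono mult_right_mono) auto
  finally show ?thesis by (simp add: mult_ac)
qed

section \<open>The probability of a large waste\<close>

lemma measurable_waste:
  assumes "online_algorithm T B p S alg"
  shows "waste T B alg \<in> borel_measurable (sample_space T p S)"
proof -
  have [measurable]: "(\<lambda>\<omega>. real (snd \<omega> t)) \<in> borel_measurable (sample_space T p S)" for t
    by (rule measurable_compose[OF measurable_snd_sample_space[of "\<lambda>N. N t"]]) simp
  note [measurable] = measurable_alloc[OF assms]
  show ?thesis unfolding waste_def by measurable
qed

lemma prob_space_sample_space:
  assumes "prob_space S"
  shows "prob_space (sample_space T p S)"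
proof -
  interpret S: prob_space S by fact
  interpret pair_prob_space S "measure_pmf (arrivals T p)" ..
  show ?thesis unfolding sample_space_def by (rule prob_space_axioms)
qed

lemma waste_prob_mono:
  assumes alg: "online_algorithm T B p S alg" and "a \<le> b"
  shows "\<P>(\<omega> in sample_space T p S. b \<le> waste T B alg \<omega>)
    \<le> \<P>(\<omega> in sample_space T p S. a \<le> waste T B alg \<omega>)"
proof -
  interpret prob_space "sample_space T p S"
    by (rule prob_space_sample_space) (use alg in \<open>simp add: online_algorithm_def\<close>)
  note [measurable] = measurable_waste[OF alg]
  show ?thesis
    by (rule finite_measure_mono) (use \<open>a \<le> b\<close> in auto)
qed

text \<open>A bad history followed by many arrivals forces unfairness, so independence gives
  \<open>P(bad) * 2/5 \<le> \<alpha>\<close>. Independence again gives a history that is not bad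
  followed by few arrivals probability at least \<open>2/5 - \<alpha>\<close>; discarding unfair
  outcomes costs another \<open>\<alpha>\<close>.\<close>

lemma waste_prob_lower_bound:
  assumes inst: "alloc_instance T B p r" and alg: "online_algorithm T B p S alg"
    and envy: "1 - \<alpha> \<le> \<P>(\<omega> in sample_space T p S. envy T alg \<omega> \<le> L)"
    and m: "1 \<le> m" "m \<le> T" and L: "0 \<le> L" and \<kappa>: "0 < \<kappa>" and d: "0 \<le> d"
    and K: "\<And>t. t \<in> {1..T} \<Longrightarrow> mean_arr p t + r t \<le> K"
  defines "I \<equiv> {m<..T}"
  defines "y \<equiv> \<Sum>t\<in>I. mean_arr p t"
  assumes low: "2 / 5 \<le> measure_pmf.prob (Pi_pmf I 0 p) {N. (\<Sum>t\<in>I. real (N t)) \<le> y}"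
    and high: "2 / 5 \<le> measure_pmf.prob (Pi_pmf I 0 p) {N. y + d \<le> (\<Sum>t\<in>I. real (N t))}"
  shows "2 / 5 - 2 * \<alpha> \<le> \<P>(\<omega> in sample_space T p S.
    min (\<kappa> * d - 2 * L * y) (B - (\<kappa> + 2 * L) * (K * real T)) \<le> waste T B alg \<omega>)"
proof -
  let ?M = "sample_space T p S"
  have S: "prob_space S" using alg by (simp add: online_algorithm_def)
  interpret M: prob_space ?M by (rule prob_space_sample_space[OF S])
  note [measurable] = measurable_alloc[OF alg] measurable_waste[OF alg]
    measurable_snd_sample_space[where T = T and p = p and S = S]
  have cover: "{1..T} = {1..m} \<union> I" "{1..m} \<inter> I = {}" "finite {1..m}" "finite I"
    using m by (auto simp: I_def)
  \<comment> \<open>Writing the horizon as past and final rounds brings the arrival law into the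
    form required for block independence.\<close>
  have M_eq: "?M = S \<Otimes>\<^sub>M measure_pmf (Pi_pmf ({1..m} \<union> I) 0 p)"
    unfolding sample_space_def arrivals_def cover(1)[symmetric] ..
  define spent where "spent \<omega> = (\<Sum>t=1..m. real (snd \<omega> t) * alloc alg \<omega> t)" for \<omega>
  \<comment> \<open>Histories after which a large number of late arrivals forces overspending or large envy.\<close>
  define bad where "bad \<omega> \<longleftrightarrow> \<kappa> \<le> alloc alg \<omega> 1 - L \<and>
    B - spent \<omega> < (alloc alg \<omega> 1 - L) * (y + d)" for \<omega>
  define few where "few N \<longleftrightarrow> (\<Sum>t\<in>I. real (N t)) \<le> y" for N :: "nat \<Rightarrow> nat"
  define many where "many N \<longleftrightarrow> y + d \<le> (\<Sum>t\<in>I. real (N t))" for N :: "nat \<Rightarrow> nat"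
  define fair where "fair \<omega> \<longleftrightarrow> (\<forall>t\<in>{1..T}. \<bar>alloc alg \<omega> t - alloc alg \<omega> 1\<bar> \<le> L)" for \<omega>
  have coord [measurable]: "(\<lambda>\<omega>. real (snd \<omega> t)) \<in> borel_measurable ?M" for t
    by (rule measurable_compose[OF measurable_snd_sample_space[of "\<lambda>N. N t"]]) simp
  have bad_meas [measurable]: "Measurable.pred ?M bad"
    unfolding bad_def spent_def by measurable
  have [measurable]: "Measurable.pred ?M (\<lambda>\<omega>. few (snd \<omega>))" "Measurable.pred ?M (\<lambda>\<omega>. many (snd \<omega>))"
    by (rule measurable_snd_sample_space)+
  have [measurable]: "Measurable.pred ?M fair" unfolding fair_def by measurable
  have bad_cong: "bad (u, N) = bad (u, N')" if "\<And>i. i \<in> {1..m} \<Longrightarrow> N i = N' i" for u N N'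
  proof -
    have "alloc alg (u, N) t = alloc alg (u, N') t" if "t \<in> {1..m}" for t
      by (rule alloc_cong) (use that \<open>\<And>i. i \<in> {1..m} \<Longrightarrow> N i = N' i\<close> in auto)
    thus ?thesis using m that by (simp add: bad_def spent_def)
  qed
  have few_cong: "few N = few N'" and many_cong: "many N = many N'"
    if "\<And>i. i \<in> I \<Longrightarrow> N i = N' i" for N N'
    using that by (simp_all add: few_def many_def)
  have indep: "M.prob {\<omega> \<in> space ?M. P \<omega> \<and> R (snd \<omega>)} =
      M.prob {\<omega> \<in> space ?M. P \<omega>} * measure_pmf.prob (Pi_pmf I 0 p) {N. R N}"
    if "Measurable.pred ?M P"
      and "\<And>u N N'. (\<And>i. i \<in> {1..m} \<Longrightarrow> N i = N' i) \<Longrightarrow> P (u, N) = P (u, N')"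
      and "\<And>N N'. (\<And>i. i \<in> I \<Longrightarrow> N i = N' i) \<Longrightarrow> R N = R N'" for P R
    using prob_pair_Pi_pmf_indep[OF S cover(3,4,2), where p = p and d = 0 and P = P and R = R] that unfolding M_eq by blast
  have supp: "AE \<omega> in ?M. \<forall>t\<in>{1..T}. real (snd \<omega> t) \<le> K"
  proof (rule AE_sample_space_arrivals[OF S, where Q = "\<lambda>t n. real n \<le> K"])
    fix t assume t: "t \<in> {1..T}"
    hence "AE n in measure_pmf (p t). \<bar>real n - mean_arr p t\<bar> \<le> r t"
      using inst by (simp add: alloc_instance_def)
    thus "AE n in measure_pmf (p t). real n \<le> K"
      by eventually_elim (use K[OF t] in linarith)
  qed
  have feas: "AE \<omega> in ?M. (\<forall>t\<in>{1..T}. 0 \<le> alloc alg \<omega> t) \<and>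
      (\<Sum>t=1..T. real (snd \<omega> t) * alloc alg \<omega> t) \<le> B"
    using alg by (simp add: online_algorithm_def)
  have "1 - \<alpha> \<le> M.prob {\<omega> \<in> space ?M. fair \<omega>}"
  proof (rule order_trans[OF envy M.finite_measure_mono])
    show "{\<omega> \<in> space ?M. envy T alg \<omega> \<le> L} \<subseteq> {\<omega> \<in> space ?M. fair \<omega>}"
    proof safe
      fix u N assume "envy T alg (u, N) \<le> L"
      thus "fair (u, N)"
        using m alloc_diff_le_envy[of 1 T _ alg "(u, N)"] alloc_diff_le_envy[of _ T 1 alg "(u, N)"]
        unfolding fair_def abs_le_iff by fastforce
    qed
  qed measurable
  hence unfair: "M.prob {\<omega> \<in> space ?M. \<not> fair \<omega>} \<le> \<alpha>"
    by (subst M.prob_neg) auto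
  \<comment> \<open>A fair outcome of this kind would spend more than \<open>B\<close>, which
    feasibility excludes almost surely.\<close>
  have "M.prob {\<omega> \<in> space ?M. bad \<omega> \<and> many (snd \<omega>)} \<le> M.prob {\<omega> \<in> space ?M. \<not> fair \<omega>}"
  proof (rule M.finite_measure_mono_AE)
    show "AE \<omega> in ?M. \<omega> \<in> {\<omega> \<in> space ?M. bad \<omega> \<and> many (snd \<omega>)} \<longrightarrow> \<omega> \<in> {\<omega> \<in> space ?M. \<not> fair \<omega>}"
      using feas
    proof eventually_elim
      case (elim \<omega>)
      have "B < (\<Sum>t=1..T. real (snd \<omega> t) * alloc alg \<omega> t)" if "bad \<omega>" "many (snd \<omega>)" "fair \<omega>"
      proof (rule final_rounds_overspend[where y = "y + d" and x = "alloc alg \<omega> 1 - L" and m = m])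
        fix t assume "t \<in> {m<..T}"
        hence "\<bar>alloc alg \<omega> t - alloc alg \<omega> 1\<bar> \<le> L"
          using \<open>fair \<omega>\<close> by (simp add: fair_def)
        thus "alloc alg \<omega> 1 - L \<le> alloc alg \<omega> t" by linarith
      qed (use that m \<kappa> in \<open>auto simp: bad_def many_def spent_def I_def\<close>)
      with elim show ?case by force
    qed
  qed measurable
  moreover have "M.prob {\<omega> \<in> space ?M. bad \<omega> \<and> many (snd \<omega>)} =
      M.prob {\<omega> \<in> space ?M. bad \<omega>} * measure_pmf.prob (Pi_pmf I 0 p) {N. many N}"
    by (rule indep[OF bad_meas bad_cong many_cong])
  moreover have "M.prob {\<omega> \<in> space ?M. bad \<omega>} * (2 / 5) \<le>
      M.prob {\<omega> \<in> space ?M. bad \<omega>} * measure_pmf.prob (Pi_pmf I 0 p) {N. many N}"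
    using high by (intro mult_left_mono) (auto simp: many_def)
  ultimately have "M.prob {\<omega> \<in> space ?M. bad \<omega>} * (2 / 5) \<le> \<alpha>"
    using unfair by linarith
  moreover have "M.prob {\<omega> \<in> space ?M. \<not> bad \<omega>} = 1 - M.prob {\<omega> \<in> space ?M. bad \<omega>}"
    by (rule M.prob_neg) measurable
  ultimately have "2 / 5 - \<alpha> \<le> M.prob {\<omega> \<in> space ?M. \<not> bad \<omega>} * (2 / 5)"
    by simp
  also have "\<dots> \<le> M.prob {\<omega> \<in> space ?M. \<not> bad \<omega>} * measure_pmf.prob (Pi_pmf I 0 p) {N. few N}"
    using low by (intro mult_left_mono) (auto simp: few_def)
  \<comment> \<open>\<open>bad\<close> reads the seed and the first \<open>m\<close> rounds,
    \<open>few\<close> only the remaining ones.\<close>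
  also have "\<dots> = M.prob {\<omega> \<in> space ?M. \<not> bad \<omega> \<and> few (snd \<omega>)}"
  proof (rule indep[symmetric])
    show "Measurable.pred ?M (\<lambda>\<omega>. \<not> bad \<omega>)" by measurable
    show "(\<not> bad (u, N)) = (\<not> bad (u, N'))" if "\<And>i. i \<in> {1..m} \<Longrightarrow> N i = N' i" for u N N'
      using bad_cong[OF that] by simp
  qed (rule few_cong)
  also have "\<dots> \<le> M.prob ({\<omega> \<in> space ?M. min (\<kappa> * d - 2 * L * y) (B - (\<kappa> + 2 * L) * (K * real T))
      \<le> waste T B alg \<omega>} \<union> {\<omega> \<in> space ?M. \<not> fair \<omega>})" (is "_ \<le> M.prob (?W \<union> ?U)")
  proof (rule M.finite_measure_mono_AE)
    show "AE \<omega> in ?M. \<omega> \<in> {\<omega> \<in> space ?M. \<not> bad \<omega> \<and> few (snd \<omega>)} \<longrightarrow> \<omega> \<in> ?W \<union> ?U"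
      using feas supp
    proof eventually_elim
      case (elim \<omega>)
      have "min (\<kappa> * d - 2 * L * y) (B - (\<kappa> + 2 * L) * (K * real T)) \<le> waste T B alg \<omega>"
        if h: "\<not> bad \<omega>" "few (snd \<omega>)" "fair \<omega>"
        unfolding waste_def
      proof (rule final_rounds_underspend[where x = "alloc alg \<omega> 1" and m = m])
        fix t assume "t \<in> {1..T}"
        hence "\<bar>alloc alg \<omega> t - alloc alg \<omega> 1\<bar> \<le> L"
          using \<open>fair \<omega>\<close> by (simp add: fair_def)
        thus "alloc alg \<omega> t \<le> alloc alg \<omega> 1 + L" by linarith
      qed (use h m \<kappa> L d elim in \<open>auto simp: bad_def few_def spent_def I_def\<close>)
      thus ?case by auto
    qed
  qed measurable
  also have "\<dots> \<le> M.prob ?W + M.prob ?U"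
    by (rule measure_Un_le) measurable
  finally show ?thesis using unfair by linarith
qed

subsection \<open>Parameters of an instance\<close>

lemma alloc_instance_integrable:
  assumes "alloc_instance T B p r" "t \<in> {1..T}"
  shows "integrable (measure_pmf (p t)) real"
  using assms
  by (intro integrable_pmf_bounded_deviation[where a = "mean_arr p t" and b = "r t"]) (simp add: alloc_instance_def)

lemma alloc_instance_mean_ge_1:
  assumes "alloc_instance T B p r" "t \<in> {1..T}"
  shows "1 \<le> mean_arr p t"
proof -
  have "AE n in measure_pmf (p t). 1 \<le> n" using assms by (simp add: alloc_instance_def)
  hence "AE n in measure_pmf (p t). (1 :: real) \<le> real n" by eventually_elim simp
  hence "measure_pmf.expectation (p t) (\<lambda>_. 1 :: real) \<le> measure_pmf.expectation (p t) real"
    by (intro integral_mono_AE alloc_instance_integrable[OF assms]) simp_all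
  thus ?thesis by (simp add: mean_arr_def)
qed

lemma alloc_instance_bounds:
  assumes inst: "alloc_instance T B p r" and t: "t \<in> {1..T}"
  shows "(sigma_min T p)\<^sup>2 \<le> var_arr p t" "mean_arr p t \<le> mu_max T p" "r t \<le> rho_max T r"
    and "AE n in measure_pmf (p t). \<bar>real n - mean_arr p t\<bar> \<le> rho_max T r"
proof -
  have pos: "0 < var_arr p t'" if "t' \<in> {1..T}" for t'
    using inst that by (simp add: alloc_instance_def)
  have "sigma_min T p \<in> (\<lambda>t. sqrt (var_arr p t)) ` {1..T}"
    unfolding sigma_min_def using t by (intro Min_in) auto
  hence "0 \<le> sigma_min T p" using pos by (auto intro: less_imp_le)
  moreover have "sigma_min T p \<le> sqrt (var_arr p t)"
    unfolding sigma_min_def using t by (intro Min_le) auto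
  ultimately have "(sigma_min T p)\<^sup>2 \<le> (sqrt (var_arr p t))\<^sup>2" by (intro power_mono)
  thus "(sigma_min T p)\<^sup>2 \<le> var_arr p t" using pos[OF t] by simp
  show "mean_arr p t \<le> mu_max T p"
    unfolding mu_max_def using t by (intro Max_ge) auto
  show r: "r t \<le> rho_max T r"
    unfolding rho_max_def using t by (intro Max_ge) auto
  have "AE n in measure_pmf (p t). \<bar>real n - mean_arr p t\<bar> \<le> r t"
    using inst t by (simp add: alloc_instance_def)
  thus "AE n in measure_pmf (p t). \<bar>real n - mean_arr p t\<bar> \<le> rho_max T r"
    by eventually_elim (use r in linarith)
qed

lemma alloc_instance_sigma_min_pos:
  assumes "alloc_instance T B p r"
  shows "0 < sigma_min T p"
proof -
  have "sigma_min T p \<in> (\<lambda>t. sqrt (var_arr p t)) ` {1..T}"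
    unfolding sigma_min_def using assms by (intro Min_in) (auto simp: alloc_instance_def)
  thus ?thesis using assms by (auto simp: alloc_instance_def)
qed

text \<open>Otherwise the arrivals of round 1 would be almost surely constant, against their
  positive variance.\<close>

lemma alloc_instance_rho_max_pos:
  assumes inst: "alloc_instance T B p r"
  shows "0 < rho_max T r"
proof (rule ccontr)
  assume neg: "\<not> ?thesis"
  have 1: "1 \<in> {1..T}" using inst by (simp add: alloc_instance_def)
  have "AE n in measure_pmf (p 1). (real n - mean_arr p 1)\<^sup>2 = 0"
    using alloc_instance_bounds(4)[OF inst 1] by eventually_elim (use neg in auto)
  hence "measure_pmf.expectation (p 1) (\<lambda>n. (real n - mean_arr p 1)\<^sup>2) = 0"
    by (rule integral_eq_zero_AE)
  moreover have "0 < var_arr p 1" using inst 1 by (simp add: alloc_instance_def)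
  ultimately show False by (simp add: var_arr_def mean_arr_def)
qed

text \<open>Every round has mean at least 1, so the expected total is at least \<open>T\<close>. The
  budget is thus linear in \<open>T\<close>, which settles the case of a small first
  allocation.\<close>

lemma alloc_instance_beta_avg:
  assumes inst: "alloc_instance T B p r"
  shows "0 < beta_avg T B p" "beta_avg T B p * real T \<le> B"
proof -
  let ?E = "measure_pmf.expectation (arrivals T p) (\<lambda>N. \<Sum>t=1..T. real (N t))"
  have T: "1 \<le> T" and B: "0 < B" using inst by (auto simp: alloc_instance_def)
  have "?E = (\<Sum>t=1..T. mean_arr p t)"
    unfolding arrivals_def mean_arr_def
    by (rule expectation_sum_Pi_pmf) (auto intro: alloc_instance_integrable[OF inst])
  also have "\<dots> \<ge> (\<Sum>t=1..T. 1)"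
    by (intro sum_mono alloc_instance_mean_ge_1[OF inst])
  finally have E: "real T \<le> ?E" by simp
  with T have "0 < ?E" by linarith
  with B E show "0 < beta_avg T B p" "beta_avg T B p * real T \<le> B"
    by (simp_all add: beta_avg_def pos_divide_le_eq mult_left_mono)
qed

subsection \<open>The lower bound\<close>

text \<open>The order of quantifiers is the point: \<open>c\<close> and the threshold in
  \<open>T\<close> are fixed before the instance, the seed law and the algorithm vary.\<close>

lemma waste_rate_eventually:
  fixes \<alpha> \<sigma> \<rho> \<mu> \<beta> :: real
  assumes \<alpha>: "\<alpha> < 1" and pos: "0 < \<sigma>" "0 < \<rho>" "0 < \<mu>" "0 < \<beta>" and L: "L \<in> o(\<lambda>_. 1)"
  shows "\<exists>c>0. \<forall>\<^sub>F T in sequentially. \<forall>B p r S alg. alloc_instance T B p r \<longrightarrow>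
    sigma_min T p = \<sigma> \<longrightarrow> rho_max T r = \<rho> \<longrightarrow> mu_max T p = \<mu> \<longrightarrow> beta_avg T B p = \<beta> \<longrightarrow>
    online_algorithm T B p S alg \<longrightarrow>
    1 - \<alpha> \<le> \<P>(\<omega> in sample_space T p S. envy T alg \<omega> \<le> L T) \<longrightarrow>
    0 \<le> L T \<and> 2 / 5 - 2 * \<alpha> \<le> \<P>(\<omega> in sample_space T p S. c * min_rate T (L T) \<le> waste T B alg \<omega>)"
proof -
  obtain z s\<^sub>0 where z: "0 < z" and spread: "\<And>(I :: nat set) p. finite I \<Longrightarrow> s\<^sub>0 \<le> card I \<Longrightarrow>
    (\<forall>i\<in>I. \<sigma>\<^sup>2 \<le> var_arr p i \<and> (AE n in measure_pmf (p i). \<bar>real n - mean_arr p i\<bar> \<le> \<rho>)) \<Longrightarrow>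
    2 / 5 \<le> measure_pmf.prob (Pi_pmf I 0 p) {N. (\<Sum>i\<in>I. real (N i)) \<le> (\<Sum>i\<in>I. mean_arr p i)} \<and>
    2 / 5 \<le> measure_pmf.prob (Pi_pmf I 0 p)
      {N. (\<Sum>i\<in>I. mean_arr p i) + z * \<sigma> * sqrt (real (card I)) \<le> (\<Sum>i\<in>I. real (N i))}"
    using pmf_sum_spread[OF pos(1), of \<rho>] by metis
  define K where "K = \<mu> + \<rho>"
  \<comment> \<open>\<open>K\<close> bounds the arrivals of a round, and
    \<open>2 * \<kappa> * K = \<beta> / 2\<close>: allocations of at most
    \<open>2 * \<kappa>\<close> leave a waste of at least \<open>\<beta> * T / 2\<close>.\<close>
  define \<kappa> where "\<kappa> = \<beta> / (4 * K)"
  \<comment> \<open>Chosen so that the envy loss \<open>2 * L T * y\<close> is at most half of the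
    gain \<open>\<kappa> * d\<close>.\<close>
  define \<delta> where "\<delta> = \<kappa> * z * \<sigma> / (4 * \<mu>)"
  define c\<^sub>1 where "c\<^sub>1 = min (1 / 2) (\<delta> / 2)"
  \<comment> \<open>The two entries belong to a small and to a large first allocation.\<close>
  define c where "c = min (\<beta> / 2) (\<kappa> * z * \<sigma> / 2 * c\<^sub>1)"
  have K: "0 < K" and \<kappa>: "0 < \<kappa>" using pos by (simp_all add: K_def \<kappa>_def)
  have \<delta>: "0 < \<delta>" using \<kappa> z pos by (simp add: \<delta>_def)
  have c: "0 < c" using \<delta> \<kappa> z pos by (simp add: c_def c\<^sub>1_def)
  have "\<forall>\<^sub>F T in sequentially. L T < \<kappa> / 2"
    using smalloD_tendsto[OF L] \<kappa> by (intro order_tendstoD(2)) auto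
  moreover have "\<forall>\<^sub>F T in sequentially. (1 :: nat) \<le> T" by (rule eventually_ge_at_top)
  ultimately have "\<forall>\<^sub>F T in sequentially. \<forall>B p r S alg. alloc_instance T B p r \<longrightarrow>
    sigma_min T p = \<sigma> \<longrightarrow> rho_max T r = \<rho> \<longrightarrow> mu_max T p = \<mu> \<longrightarrow> beta_avg T B p = \<beta> \<longrightarrow>
    online_algorithm T B p S alg \<longrightarrow>
    1 - \<alpha> \<le> \<P>(\<omega> in sample_space T p S. envy T alg \<omega> \<le> L T) \<longrightarrow>
    0 \<le> L T \<and> 2 / 5 - 2 * \<alpha> \<le> \<P>(\<omega> in sample_space T p S. c * min_rate T (L T) \<le> waste T B alg \<omega>)"
    using final_rounds[OF L \<delta>, of s\<^sub>0]
  proof eventually_elim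
    case (elim T)
    show ?case
    proof (intro allI impI)
      fix B p r S alg
      assume inst: "alloc_instance T B p r" and params: "sigma_min T p = \<sigma>" "rho_max T r = \<rho>"
        "mu_max T p = \<mu>" "beta_avg T B p = \<beta>"
        and alg: "online_algorithm T B p S alg"
        and envy: "1 - \<alpha> \<le> \<P>(\<omega> in sample_space T p S. envy T alg \<omega> \<le> L T)"
      note bounds = alloc_instance_bounds[OF inst, unfolded params]
      \<comment> \<open>Envy is never negative, so a negative bound would hold with probability 0,
        below \<open>1 - \<alpha>\<close>.\<close>
      have L: "0 \<le> L T"
      proof (rule ccontr)
        assume "\<not> 0 \<le> L T"
        hence "{\<omega> \<in> space (sample_space T p S). envy T alg \<omega> \<le> L T} = {}"
          using envy_nonneg[OF elim(2), of alg] by (auto simp: not_le intro: less_le_trans)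
        with envy \<alpha> show False by simp
      qed
      then obtain s where s: "s\<^sub>0 \<le> s" "s < T" "L T * sqrt (real s) \<le> \<delta>"
        "c\<^sub>1 * min_rate T (L T) \<le> sqrt (real s)"
        using elim(3) unfolding c\<^sub>1_def by blast
      define m where "m = T - s"
      define d where "d = z * \<sigma> * sqrt (real s)"
      define y where "y = (\<Sum>t\<in>{m<..T}. mean_arr p t)"
      have m: "1 \<le> m" "m \<le> T" "card {m<..T} = s" using s(2) by (auto simp: m_def)
      have "2 / 5 \<le> measure_pmf.prob (Pi_pmf {m<..T} 0 p) {N. (\<Sum>i\<in>{m<..T}. real (N i)) \<le> y} \<and>
        2 / 5 \<le> measure_pmf.prob (Pi_pmf {m<..T} 0 p) {N. y + d \<le> (\<Sum>i\<in>{m<..T}. real (N i))}"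
        unfolding y_def d_def using spread[of "{m<..T}" p, unfolded m(3)] s(1) bounds m(1) by simp
      hence prob: "2 / 5 - 2 * \<alpha> \<le> \<P>(\<omega> in sample_space T p S.
          min (\<kappa> * d - 2 * L T * y) (B - (\<kappa> + 2 * L T) * (K * real T)) \<le> waste T B alg \<omega>)"
        unfolding y_def using z pos bounds(2,3)
        by (intro waste_prob_lower_bound[OF inst alg envy m(1,2) L \<kappa>])
           (auto simp: d_def K_def intro: add_mono)
      have "y \<le> (\<Sum>t\<in>{m<..T}. \<mu>)"
        unfolding y_def using bounds(2) m by (intro sum_mono) auto
      hence "2 * L T * y \<le> 2 * L T * (real s * \<mu>)"
        using L m by (intro mult_left_mono) auto
      also have "\<dots> = 2 * \<mu> * (L T * sqrt (real s)) * sqrt (real s)"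
        by (simp add: mult_ac)
      also have "\<dots> \<le> 2 * \<mu> * \<delta> * sqrt (real s)"
        using s(3) pos by (intro mult_right_mono mult_left_mono) auto
      also have "\<dots> = \<kappa> * d / 2"
        using pos by (simp add: \<delta>_def d_def)
      finally have "\<kappa> * z * \<sigma> / 2 * sqrt (real s) \<le> \<kappa> * d - 2 * L T * y"
        by (simp add: d_def mult_ac)
      moreover have "\<kappa> * z * \<sigma> / 2 * (c\<^sub>1 * min_rate T (L T)) \<le> \<kappa> * z * \<sigma> / 2 * sqrt (real s)"
        using s(4) \<kappa> z pos by (intro mult_left_mono) auto
      moreover have "c * min_rate T (L T) \<le> \<kappa> * z * \<sigma> / 2 * c\<^sub>1 * min_rate T (L T)"
        using min_rate_nonneg[OF L, of T] by (intro mult_right_mono) (auto simp: c_def)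
      ultimately have 1: "c * min_rate T (L T) \<le> \<kappa> * d - 2 * L T * y"
        by (simp only: mult.assoc)
      \<comment> \<open>Here \<open>L T < \<kappa> / 2\<close> is used; the waste is then linear in
        \<open>T\<close>, which dominates a rate of at most \<open>sqrt T\<close>.\<close>
      have "(\<kappa> + 2 * L T) * (K * real T) \<le> (2 * \<kappa>) * (K * real T)"
        using elim(1) K by (intro mult_right_mono) auto
      also have "\<dots> = \<beta> / 2 * real T"
        using K by (simp add: \<kappa>_def)
      finally have "\<beta> / 2 * real T \<le> B - (\<kappa> + 2 * L T) * (K * real T)"
        using alloc_instance_beta_avg(2)[OF inst] unfolding params by simp
      moreover have "sqrt (real T) \<le> real T"
        using elim(2) by (intro real_le_lsqrt) (auto simp: power2_eq_square)
      hence "min_rate T (L T) \<le> real T"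
        using min_rate_le_sqrt[of T "L T"] by linarith
      hence "c * min_rate T (L T) \<le> \<beta> / 2 * real T"
        using c pos min_rate_nonneg[OF L] by (intro mult_mono) (auto simp: c_def)
      ultimately have "c * min_rate T (L T) \<le>
          min (\<kappa> * d - 2 * L T * y) (B - (\<kappa> + 2 * L T) * (K * real T))"
        using 1 by linarith
      hence "\<P>(\<omega> in sample_space T p S. min (\<kappa> * d - 2 * L T * y)
            (B - (\<kappa> + 2 * L T) * (K * real T)) \<le> waste T B alg \<omega>)
          \<le> \<P>(\<omega> in sample_space T p S. c * min_rate T (L T) \<le> waste T B alg \<omega>)"
        using waste_prob_mono[OF alg] by blast
      with L prob show "0 \<le> L T \<and> 2 / 5 - 2 * \<alpha> \<le>
          \<P>(\<omega> in sample_space T p S. c * min_rate T (L T) \<le> waste T B alg \<omega>)"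
        by linarith
    qed
  qed
  with c show ?thesis by blast
qed

text \<open>The error sequences may depend on the constants and on \<open>L\<close>, but are chosen
  before the instance, the seed law and the algorithm.\<close>

theorem theorem4p4:
  "\<exists>C>0. \<forall>(\<alpha>::real) (\<sigma>::real) (\<rho>::real) (\<mu>::real) (\<beta>::real) (L::nat \<Rightarrow> real).
     0 < \<alpha> \<and> \<alpha> < 1 / 8 \<and> L \<in> o(\<lambda>_. 1) \<longrightarrow>
     (\<exists>(\<epsilon>\<^sub>1::nat \<Rightarrow> real) (\<epsilon>\<^sub>2::nat \<Rightarrow> real) (\<epsilon>\<^sub>3::nat \<Rightarrow> real).
        \<epsilon>\<^sub>1 \<in> o(\<lambda>_. 1) \<and> \<epsilon>\<^sub>2 \<in> o(\<lambda>_. 1) \<and> \<epsilon>\<^sub>3 \<in> o(\<lambda>_. 1) \<and>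
        (\<forall>T B p r S alg.
           alloc_instance T B p r \<and>
           sigma_min T p = \<sigma> \<and> rho_max T r = \<rho> \<and> mu_max T p = \<mu> \<and> beta_avg T B p = \<beta> \<and>
           3 * \<alpha> + C * \<rho> / (\<sigma> ^ 3 * sqrt (real T)) < 1 / 2 \<and>
           online_algorithm T B p S alg \<and>
           \<P>(\<omega> in sample_space T p S. envy T alg \<omega> \<le> L T) \<ge> 1 - \<alpha> \<longrightarrow>
           \<P>(\<omega> in sample_space T p S.
               waste T B alg \<omega> \<ge> C_tilde C \<alpha> \<sigma> \<rho> \<mu> (\<beta> - \<epsilon>\<^sub>1 T) T * min_rate T (L T) - \<epsilon>\<^sub>2 T)
             \<ge> 1 / 12 - \<epsilon>\<^sub>3 T))"
\<comment> \<open>The value 1 suffices: \<open>C\<close> enters the bound only through the argument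
  of the quantile, which the smallness condition keeps above 1/2.\<close>
proof (rule exI[of _ 1], intro conjI allI impI)
  fix \<alpha> \<sigma> \<rho> \<mu> \<beta> :: real and L :: "nat \<Rightarrow> real"
  assume *: "0 < \<alpha> \<and> \<alpha> < 1 / 8 \<and> L \<in> o(\<lambda>_. 1)"
  \<comment> \<open>The bound holds without error terms for all but finitely many \<open>T\<close>; \<open>\<epsilon>\<^sub>3\<close> absorbs the rest.\<close>
  define good where "good T \<longleftrightarrow> (\<forall>B p r S alg.
     alloc_instance T B p r \<and>
     sigma_min T p = \<sigma> \<and> rho_max T r = \<rho> \<and> mu_max T p = \<mu> \<and> beta_avg T B p = \<beta> \<and>
     3 * \<alpha> + 1 * \<rho> / (\<sigma> ^ 3 * sqrt (real T)) < 1 / 2 \<and>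
     online_algorithm T B p S alg \<and>
     \<P>(\<omega> in sample_space T p S. envy T alg \<omega> \<le> L T) \<ge> 1 - \<alpha> \<longrightarrow>
     \<P>(\<omega> in sample_space T p S. waste T B alg \<omega> \<ge> C_tilde 1 \<alpha> \<sigma> \<rho> \<mu> \<beta> T * min_rate T (L T))
       \<ge> 1 / 12)" for T
  have good: "\<forall>\<^sub>F T in sequentially. good T"
  proof (cases "0 < \<sigma> \<and> 0 < \<rho> \<and> 0 < \<mu> \<and> 0 < \<beta>")
    case True
    then obtain c where c: "0 < c" and rate: "\<forall>\<^sub>F T in sequentially. \<forall>B p r S alg. alloc_instance T B p r \<longrightarrow>
      sigma_min T p = \<sigma> \<longrightarrow> rho_max T r = \<rho> \<longrightarrow> mu_max T p = \<mu> \<longrightarrow> beta_avg T B p = \<beta> \<longrightarrow>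
      online_algorithm T B p S alg \<longrightarrow>
      1 - \<alpha> \<le> \<P>(\<omega> in sample_space T p S. envy T alg \<omega> \<le> L T) \<longrightarrow>
      0 \<le> L T \<and> 2 / 5 - 2 * \<alpha> \<le> \<P>(\<omega> in sample_space T p S. c * min_rate T (L T) \<le> waste T B alg \<omega>)"
      using waste_rate_eventually[of \<alpha> \<sigma> \<rho> \<mu> \<beta> L] * by auto
    have "\<forall>\<^sub>F T in sequentially. 3 * \<alpha> + 1 * \<rho> / (\<sigma> ^ 3 * sqrt (real T)) < 1 / 2 \<longrightarrow>
        C_tilde 1 \<alpha> \<sigma> \<rho> \<mu> \<beta> T \<le> c"
      using * True c by (intro C_tilde_vanishes) auto
    with rate show ?thesis
    proof eventually_elim
      case (elim T)
      show ?case unfolding good_def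
      proof (intro allI impI, elim conjE)
        fix B p r S alg
        assume h: "alloc_instance T B p r" "sigma_min T p = \<sigma>" "rho_max T r = \<rho>" "mu_max T p = \<mu>"
          "beta_avg T B p = \<beta>" "online_algorithm T B p S alg"
          "\<P>(\<omega> in sample_space T p S. envy T alg \<omega> \<le> L T) \<ge> 1 - \<alpha>"
          and small: "3 * \<alpha> + 1 * \<rho> / (\<sigma> ^ 3 * sqrt (real T)) < 1 / 2"
        have L: "0 \<le> L T" and prob: "2 / 5 - 2 * \<alpha> \<le>
            \<P>(\<omega> in sample_space T p S. c * min_rate T (L T) \<le> waste T B alg \<omega>)"
          using elim(1) h by blast+
        have "C_tilde 1 \<alpha> \<sigma> \<rho> \<mu> \<beta> T * min_rate T (L T) \<le> c * min_rate T (L T)"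
          using elim(2) small min_rate_nonneg[OF L] by (intro mult_right_mono) auto
        \<comment> \<open>With \<open>\<alpha> < 1 / 8\<close> the probability is above
          \<open>2/5 - 1/4 = 3/20\<close>, hence above 1/12.\<close>
        from waste_prob_mono[OF h(6) this] prob *
        show "1 / 12 \<le> \<P>(\<omega> in sample_space T p S.
            C_tilde 1 \<alpha> \<sigma> \<rho> \<mu> \<beta> T * min_rate T (L T) \<le> waste T B alg \<omega>)"
          by linarith
      qed
    qed
  next
    \<comment> \<open>No instance has such parameters, so the claim is vacuous.\<close>
    case False
    have "good T" for T
      unfolding good_def
    proof (intro allI impI, elim conjE)
      fix B p r S alg
      assume inst: "alloc_instance T B p r" and params: "sigma_min T p = \<sigma>" "rho_max T r = \<rho>"
        "mu_max T p = \<mu>" "beta_avg T B p = \<beta>"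
      have 1: "1 \<in> {1..T}" using inst by (simp add: alloc_instance_def)
      have "0 < \<mu>"
        using alloc_instance_mean_ge_1[OF inst 1] alloc_instance_bounds(2)[OF inst 1] params by simp
      with False show "1 / 12 \<le> \<P>(\<omega> in sample_space T p S.
          C_tilde 1 \<alpha> \<sigma> \<rho> \<mu> \<beta> T * min_rate T (L T) \<le> waste T B alg \<omega>)"
        using alloc_instance_sigma_min_pos[OF inst] alloc_instance_rho_max_pos[OF inst]
          alloc_instance_beta_avg(1)[OF inst] params by simp
    qed
    thus ?thesis by simp
  qed
  define \<epsilon> :: "nat \<Rightarrow> real" where "\<epsilon> T = (if good T then 0 else 1)" for T
  have \<epsilon>: "\<epsilon> \<in> o(\<lambda>_. 1)"
  proof (rule smalloI_tendsto)
    have "\<forall>\<^sub>F T in sequentially. \<epsilon> T / 1 = 0"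
      using good by eventually_elim (simp add: \<epsilon>_def)
    thus "(\<lambda>T. \<epsilon> T / 1) \<longlonglongrightarrow> 0" by (rule tendsto_eventually)
  qed simp
  show "\<exists>(\<epsilon>\<^sub>1::nat \<Rightarrow> real) (\<epsilon>\<^sub>2::nat \<Rightarrow> real) (\<epsilon>\<^sub>3::nat \<Rightarrow> real).
        \<epsilon>\<^sub>1 \<in> o(\<lambda>_. 1) \<and> \<epsilon>\<^sub>2 \<in> o(\<lambda>_. 1) \<and> \<epsilon>\<^sub>3 \<in> o(\<lambda>_. 1) \<and>
        (\<forall>T B p r S alg.
           alloc_instance T B p r \<and>
           sigma_min T p = \<sigma> \<and> rho_max T r = \<rho> \<and> mu_max T p = \<mu> \<and> beta_avg T B p = \<beta> \<and>
           3 * \<alpha> + 1 * \<rho> / (\<sigma> ^ 3 * sqrt (real T)) < 1 / 2 \<and>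
           online_algorithm T B p S alg \<and>
           \<P>(\<omega> in sample_space T p S. envy T alg \<omega> \<le> L T) \<ge> 1 - \<alpha> \<longrightarrow>
           \<P>(\<omega> in sample_space T p S.
               waste T B alg \<omega> \<ge> C_tilde 1 \<alpha> \<sigma> \<rho> \<mu> (\<beta> - \<epsilon>\<^sub>1 T) T * min_rate T (L T) - \<epsilon>\<^sub>2 T)
             \<ge> 1 / 12 - \<epsilon>\<^sub>3 T)"
  proof (rule exI[of _ "\<lambda>_. 0"], rule exI[of _ "\<lambda>_. 0"], rule exI[of _ \<epsilon>],
      intro conjI allI impI)
    fix T B p r S alg
    assume "alloc_instance T B p r \<and>
       sigma_min T p = \<sigma> \<and> rho_max T r = \<rho> \<and> mu_max T p = \<mu> \<and> beta_avg T B p = \<beta> \<and>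
       3 * \<alpha> + 1 * \<rho> / (\<sigma> ^ 3 * sqrt (real T)) < 1 / 2 \<and>
       online_algorithm T B p S alg \<and>
       \<P>(\<omega> in sample_space T p S. envy T alg \<omega> \<le> L T) \<ge> 1 - \<alpha>"
    hence "1 / 12 \<le> \<P>(\<omega> in sample_space T p S.
        waste T B alg \<omega> \<ge> C_tilde 1 \<alpha> \<sigma> \<rho> \<mu> \<beta> T * min_rate T (L T))" if "good T"
      using that unfolding good_def by blast
    moreover have "0 \<le> \<P>(\<omega> in sample_space T p S.
        waste T B alg \<omega> \<ge> C_tilde 1 \<alpha> \<sigma> \<rho> \<mu> \<beta> T * min_rate T (L T))"
      by (rule measure_nonneg)
    hence "1 / 12 - 1 \<le> \<P>(\<omega> in sample_space T p S.
        waste T B alg \<omega> \<ge> C_tilde 1 \<alpha> \<sigma> \<rho> \<mu> \<beta> T * min_rate T (L T))"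
      by linarith
    ultimately show "1 / 12 - \<epsilon> T \<le> \<P>(\<omega> in sample_space T p S.
        waste T B alg \<omega> \<ge> C_tilde 1 \<alpha> \<sigma> \<rho> \<mu> (\<beta> - 0) T * min_rate T (L T) - 0)"
      by (cases "good T") (simp_all add: \<epsilon>_def)
  qed (simp_all add: \<epsilon>)
qed simp

end
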